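(* (Cartan Formula) Let $K$ be a simplicial complex on the vertex set $[m]$ and let $(\underline{U},\underline{V})=(\underline{B\vee C},\underline{B\vee E})$ be a wedge decomposable family of pairs, i.e. $(U_i,V_i)=(B_i\vee C_i,\,B_i\vee E_i)$ for $i=1,\dots,m$, where each $E_i\hookrightarrow C_i$ is a null homotopic inclusion. Then there is a homotopy equivalence $$\widehat{Z}\big(K;(\underline{U},\underline{V})\big)\longrightarrow \bigvee_{I\subseteq [m]}\Big(\widehat{Z}\big(K_I;(\underline{C},\underline{E})_I\big)\wedge \widehat{Z}\big(K_{[m]-I};(\underline{B},\underline{B})_{[m]-I}\big)\Big)$$ which is natural with respect to maps of decomposable pairs. Of course, $\widehat{Z}\big(K_{[m]-I};(\underline{B},\underline{B})_{[m]-I}\big)=\bigwedge_{j\in[m]-I}B_j$, with the convention that $\widehat{Z}(K_\varnothing;(\underline{B},\underline{B})_\varnothing)$, $\widehat{Z}(K_\varnothing;(\underline{C},\underline{E})_\varnothing)$ and $\widehat{Z}(K_I;(\varnothing,\varnothing)_I)$ are all equal to $S^0$.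
   Context: $[m]=\{1,\dots,m\}$. A simplicial complex $K$ on $[m]$ contains the empty simplex; elements of $[m]$ need not be vertices of $K$ (ghost vertices are allowed). For a family $(\underline{X},\underline{A})=\{(X_i,A_i)\}_{i=1}^m$ of pointed CW pairs, the polyhedral smash product is $$\widehat{Z}(K;(\underline{X},\underline{A}))=\bigcup_{\sigma\in K}\widehat{D}(\sigma)\subseteq X_1\wedge\cdots\wedge X_m,\qquad \widehat{D}(\sigma)=\bigwedge_{i=1}^m W_i,$$ with $W_i=X_i$ if $i\in\sigma$ and $W_i=A_i$ if $i\in[m]-\sigma$. For $I\subseteq[m]$, $K_I=\{\sigma\in K:\sigma\subseteq I\}$ is the full subcomplex on $I$, $(\underline{X},\underline{A})_I=\{(X_i,A_i)\}_{i\in I}$ is the restricted family, and $\widehat{Z}(K_I;(\underline{X},\underline{A})_I)\subseteq\bigwedge_{i\in I}X_i$ is the corresponding polyhedral smash product. All $B_i,C_i,E_i$ are pointed CW complexes, and $B_i\vee E_i\subseteq B_i\vee C_i$ is the evident inclusion. *)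

theory Defs
  imports "HOL-Analysis.Analysis"
begin

section \<open>Pointed spaces and pointed homotopy equivalences\<close>

type_synonym 'a pointed = "'a topology \<times> 'a"

abbreviation spc :: "'a pointed \<Rightarrow> 'a topology" where "spc \<equiv> fst"
abbreviation pt :: "'a pointed \<Rightarrow> 'a" where "pt \<equiv> snd"
abbreviation pts :: "'a pointed \<Rightarrow> 'a set" where "pts X \<equiv> topspace (spc X)"

definition subspace_pointed :: "'a pointed \<Rightarrow> 'a set \<Rightarrow> 'a pointed" where
  "subspace_pointed X A = (subtopology (spc X) A, pt X)"

definition pointed_map :: "'a pointed \<Rightarrow> 'b pointed \<Rightarrow> ('a \<Rightarrow> 'b) \<Rightarrow> bool" where
  "pointed_map X Y f \<longleftrightarrow> continuous_map (spc X) (spc Y) f \<and> f (pt X) = pt Y"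

definition pointed_homotopy_equivalence :: "'a pointed \<Rightarrow> 'b pointed \<Rightarrow> ('a \<Rightarrow> 'b) \<Rightarrow> bool" where
  "pointed_homotopy_equivalence X Y f \<longleftrightarrow>
     pointed_map X Y f \<and>
     (\<exists>g. pointed_map Y X g \<and>
          homotopic_with (\<lambda>h. h (pt X) = pt X) (spc X) (spc X) (g \<circ> f) id \<and>
          homotopic_with (\<lambda>h. h (pt Y) = pt Y) (spc Y) (spc Y) (f \<circ> g) id)"

text \<open>The null homotopy is not required to fix the base point. For complexes based at a vertex
  this is equivalent to the existence of a pointed null homotopy.\<close>
definition null_homotopic_inclusion :: "'a topology \<Rightarrow> 'a set \<Rightarrow> bool" where
  "null_homotopic_inclusion X A \<longleftrightarrow>
     (\<exists>c \<in> topspace X. homotopic_with (\<lambda>_. True) (subtopology X A) X id (\<lambda>_. c))"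


section \<open>CW complexes\<close>

definition disk :: "nat \<Rightarrow> (nat \<Rightarrow> real) topology" where
  "disk n = subtopology (Euclidean_space n) {x. (\<Sum>i<n. (x i)\<^sup>2) \<le> 1}"

definition disk_interior :: "nat \<Rightarrow> (nat \<Rightarrow> real) set" where
  "disk_interior n = {x \<in> topspace (disk n). (\<Sum>i<n. (x i)\<^sup>2) < 1}"

definition disk_boundary :: "nat \<Rightarrow> (nat \<Rightarrow> real) set" where
  "disk_boundary n = {x \<in> topspace (disk n). (\<Sum>i<n. (x i)\<^sup>2) = 1}"

text \<open>Whitehead's definition: \<open>\<C>\<close> is the set of open cells and \<open>d\<close> gives their dimensions.
  The last two clauses are closure finiteness and the weak topology.\<close>
definition cw_structure :: "'a topology \<Rightarrow> 'a set set \<Rightarrow> ('a set \<Rightarrow> nat) \<Rightarrow> bool" where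
  "cw_structure X \<C> d \<longleftrightarrow>
     Hausdorff_space X \<and>
     disjoint \<C> \<and> \<Union>\<C> = topspace X \<and>
     (\<forall>e\<in>\<C>. \<exists>\<phi>. continuous_map (disk (d e)) X \<phi> \<and>
        homeomorphic_map (subtopology (disk (d e)) (disk_interior (d e))) (subtopology X e) \<phi> \<and>
        (\<exists>\<F>\<subseteq>\<C>. finite \<F> \<and> (\<forall>c\<in>\<F>. d c < d e) \<and> \<phi> ` disk_boundary (d e) \<subseteq> \<Union>\<F>)) \<and>
     (\<forall>A\<subseteq>topspace X. (\<forall>e\<in>\<C>. closedin X (A \<inter> X closure_of e)) \<longrightarrow> closedin X A)"

definition cw_subcomplex :: "'a topology \<Rightarrow> 'a set set \<Rightarrow> 'a set \<Rightarrow> bool" where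
  "cw_subcomplex X \<C> A \<longleftrightarrow> (\<exists>\<D>\<subseteq>\<C>. A = \<Union>\<D> \<and> (\<forall>e\<in>\<D>. X closure_of e \<subseteq> A))"

text \<open>Base points are vertices.\<close>
definition pointed_CW_complex :: "'a pointed \<Rightarrow> bool" where
  "pointed_CW_complex X \<longleftrightarrow>
     (\<exists>\<C> d. cw_structure (spc X) \<C> d \<and> {pt X} \<in> \<C> \<and> d {pt X} = 0)"

definition pointed_CW_pair :: "'a pointed \<Rightarrow> 'a set \<Rightarrow> bool" where
  "pointed_CW_pair X A \<longleftrightarrow>
     (\<exists>\<C> d. cw_structure (spc X) \<C> d \<and> {pt X} \<in> \<C> \<and> d {pt X} = 0 \<and>
        cw_subcomplex (spc X) \<C> A \<and> pt X \<in> A)"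


section \<open>Collapsing a subset, products, wedges and smash products\<close>

text \<open>The pointed quotient \<open>X/A\<close>. The class of \<open>A\<close> is \<open>None\<close>, which is always a point of the
  quotient: collapsing the empty set adds a disjoint base point.\<close>

definition collapse_map :: "'a set \<Rightarrow> 'a \<Rightarrow> 'a option" where
  "collapse_map A x = (if x \<in> A then None else Some x)"

definition collapse :: "'a topology \<Rightarrow> 'a set \<Rightarrow> 'a option pointed" where
  "collapse X A =
     (topology (\<lambda>U. U \<subseteq> insert None (Some ` (topspace X - A)) \<and>
                    openin X {x \<in> topspace X. collapse_map A x \<in> U}), None)"

text \<open>The map into the quotient by \<open>B\<close> induced by \<open>g\<close>.\<close>
definition collapse_fun :: "'b set \<Rightarrow> ('a \<Rightarrow> 'b) \<Rightarrow> 'a option \<Rightarrow> 'b option" where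
  "collapse_fun B g z = (case z of None \<Rightarrow> None | Some x \<Rightarrow> collapse_map B (g x))"

text \<open>Products of CW complexes carry the compactly generated topology (\<open>kification\<close>), so that they
  are CW complexes again and the smash product is associative.\<close>

definition fat_wedge :: "'i set \<Rightarrow> ('i \<Rightarrow> 'a pointed) \<Rightarrow> ('i \<Rightarrow> 'a) set" where
  "fat_wedge J X = {x \<in> (\<Pi>\<^sub>E i\<in>J. pts (X i)). \<exists>i\<in>J. x i = pt (X i)}"

definition smash :: "'i set \<Rightarrow> ('i \<Rightarrow> 'a pointed) \<Rightarrow> ('i \<Rightarrow> 'a) option pointed" where
  "smash J X = collapse (kification (product_topology (\<lambda>i. spc (X i)) J)) (fat_wedge J X)"

definition smash_map ::
  "'i set \<Rightarrow> ('i \<Rightarrow> 'b pointed) \<Rightarrow> ('i \<Rightarrow> 'a \<Rightarrow> 'b) \<Rightarrow> ('i \<Rightarrow> 'a) option \<Rightarrow> ('i \<Rightarrow> 'b) option"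
  where "smash_map J Y f = collapse_fun (fat_wedge J Y) (\<lambda>x. \<lambda>i\<in>J. f i (x i))"

definition axes :: "'a pointed \<Rightarrow> 'b pointed \<Rightarrow> ('a \<times> 'b) set" where
  "axes X Y = pts X \<times> {pt Y} \<union> {pt X} \<times> pts Y"

definition smash2 :: "'a pointed \<Rightarrow> 'b pointed \<Rightarrow> ('a \<times> 'b) option pointed" where
  "smash2 X Y = collapse (kification (prod_topology (spc X) (spc Y))) (axes X Y)"

definition smash2_map ::
  "'c pointed \<Rightarrow> 'd pointed \<Rightarrow> ('a \<Rightarrow> 'c) \<Rightarrow> ('b \<Rightarrow> 'd) \<Rightarrow> ('a \<times> 'b) option \<Rightarrow> ('c \<times> 'd) option"
  where "smash2_map X' Y' f g = collapse_fun (axes X' Y') (map_prod f g)"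

definition wedge :: "'i set \<Rightarrow> ('i \<Rightarrow> 'a pointed) \<Rightarrow> ('i \<times> 'a) option pointed" where
  "wedge J X = collapse (sum_topology (\<lambda>i. spc (X i)) J) ((\<lambda>i. (i, pt (X i))) ` J)"

definition wedge_map ::
  "'i set \<Rightarrow> ('i \<Rightarrow> 'b pointed) \<Rightarrow> ('i \<Rightarrow> 'a \<Rightarrow> 'b) \<Rightarrow> ('i \<times> 'a) option \<Rightarrow> ('i \<times> 'b) option"
  where "wedge_map J Y f = collapse_fun ((\<lambda>i. (i, pt (Y i))) ` J) (\<lambda>(i, x). (i, f i x))"

definition disjoint_sum :: "'a topology \<Rightarrow> 'b topology \<Rightarrow> ('a + 'b) topology" where
  "disjoint_sum X Y = topology (\<lambda>U. openin X (Inl -` U) \<and> openin Y (Inr -` U))"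

definition wedge2 :: "'a pointed \<Rightarrow> 'b pointed \<Rightarrow> ('a + 'b) option pointed" where
  "wedge2 X Y = collapse (disjoint_sum (spc X) (spc Y)) {Inl (pt X), Inr (pt Y)}"

definition wedge2_map ::
  "'c pointed \<Rightarrow> 'd pointed \<Rightarrow> ('a \<Rightarrow> 'c) \<Rightarrow> ('b \<Rightarrow> 'd) \<Rightarrow> ('a + 'b) option \<Rightarrow> ('c + 'd) option"
  where "wedge2_map X' Y' f g = collapse_fun {Inl (pt X'), Inr (pt Y')} (map_sum f g)"


section \<open>Polyhedral smash products\<close>

text \<open>Ghost vertices are allowed: \<open>{i} \<in> K\<close> is not required.\<close>
definition simplicial_complex_on :: "'i set \<Rightarrow> 'i set set \<Rightarrow> bool" where
  "simplicial_complex_on V K \<longleftrightarrow>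
     K \<subseteq> Pow V \<and> {} \<in> K \<and> (\<forall>\<sigma>\<in>K. \<forall>\<tau>\<subseteq>\<sigma>. \<tau> \<in> K)"

definition full_subcomplex :: "'i set set \<Rightarrow> 'i set \<Rightarrow> 'i set set" where
  "full_subcomplex K I = {\<sigma> \<in> K. \<sigma> \<subseteq> I}"

text \<open>As points of a smash product are tuples of non-base points together with \<open>None\<close>, the smash
  product of the \<open>W\<^sub>i\<close> is literally a subset of the smash product of the \<open>X\<^sub>i\<close>.\<close>
definition Dhat :: "'i set \<Rightarrow> 'i set \<Rightarrow> ('i \<Rightarrow> 'a pointed) \<Rightarrow> ('i \<Rightarrow> 'a set) \<Rightarrow> ('i \<Rightarrow> 'a) option set"
  where "Dhat J \<sigma> X A =
     pts (smash J (\<lambda>i. subspace_pointed (X i) (if i \<in> \<sigma> then pts (X i) else A i)))"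

text \<open>The polyhedral smash product, over the index set \<open>J\<close>, of the family of pairs
  \<open>(X\<^sub>i, A\<^sub>i)\<close>. Only the indices in \<open>J\<close> matter, so that
  \<open>Zhat I (full_subcomplex K I) X A\<close> uses the restricted family.\<close>
definition Zhat ::
  "'i set \<Rightarrow> 'i set set \<Rightarrow> ('i \<Rightarrow> 'a pointed) \<Rightarrow> ('i \<Rightarrow> 'a set) \<Rightarrow> ('i \<Rightarrow> 'a) option pointed"
  where "Zhat J K X A = subspace_pointed (smash J X) (\<Union>\<sigma>\<in>K. Dhat J \<sigma> X A)"


section \<open>Wedge decomposable families\<close>

definition wedge_decomposable ::
  "'i set \<Rightarrow> ('i \<Rightarrow> 'b pointed) \<Rightarrow> ('i \<Rightarrow> 'c pointed) \<Rightarrow> ('i \<Rightarrow> 'c set) \<Rightarrow> bool" where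
  "wedge_decomposable J B C E \<longleftrightarrow>
     (\<forall>i\<in>J. pointed_CW_complex (B i) \<and> pointed_CW_pair (C i) (E i) \<and>
            null_homotopic_inclusion (spc (C i)) (E i))"

definition wedge_U ::
  "('i \<Rightarrow> 'b pointed) \<Rightarrow> ('i \<Rightarrow> 'c pointed) \<Rightarrow> 'i \<Rightarrow> ('b + 'c) option pointed" where
  "wedge_U B C i = wedge2 (B i) (C i)"

definition wedge_V ::
  "('i \<Rightarrow> 'b pointed) \<Rightarrow> ('i \<Rightarrow> 'c pointed) \<Rightarrow> ('i \<Rightarrow> 'c set) \<Rightarrow> 'i \<Rightarrow> ('b + 'c) option set"
  where "wedge_V B C E i = pts (wedge2 (B i) (subspace_pointed (C i) (E i)))"

text \<open>Maps of decomposable pairs respect the decomposition: they are induced by pointed maps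
  \<open>B\<^sub>i \<rightarrow> B'\<^sub>i\<close> and pointed maps of pairs \<open>(C\<^sub>i, E\<^sub>i) \<rightarrow> (C'\<^sub>i, E'\<^sub>i)\<close>.\<close>
definition decomposable_map ::
  "'i set \<Rightarrow> ('i \<Rightarrow> 'b pointed) \<Rightarrow> ('i \<Rightarrow> 'c pointed) \<Rightarrow> ('i \<Rightarrow> 'c set) \<Rightarrow>
   ('i \<Rightarrow> 'b pointed) \<Rightarrow> ('i \<Rightarrow> 'c pointed) \<Rightarrow> ('i \<Rightarrow> 'c set) \<Rightarrow>
   ('i \<Rightarrow> 'b \<Rightarrow> 'b) \<Rightarrow> ('i \<Rightarrow> 'c \<Rightarrow> 'c) \<Rightarrow> bool" where
  "decomposable_map J B C E B' C' E' \<beta> \<gamma> \<longleftrightarrow>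
     (\<forall>i\<in>J. pointed_map (B i) (B' i) (\<beta> i) \<and> pointed_map (C i) (C' i) (\<gamma> i) \<and>
            \<gamma> i ` E i \<subseteq> E' i)"

definition decomposable_Zhat ::
  "'i set \<Rightarrow> 'i set set \<Rightarrow> ('i \<Rightarrow> 'b pointed) \<Rightarrow> ('i \<Rightarrow> 'c pointed) \<Rightarrow> ('i \<Rightarrow> 'c set) \<Rightarrow>
   ('i \<Rightarrow> ('b + 'c) option) option pointed" where
  "decomposable_Zhat J K B C E = Zhat J K (wedge_U B C) (wedge_V B C E)"

definition decomposable_Zhat_map ::
  "'i set \<Rightarrow> ('i \<Rightarrow> 'b pointed) \<Rightarrow> ('i \<Rightarrow> 'c pointed) \<Rightarrow> ('i \<Rightarrow> 'b \<Rightarrow> 'b) \<Rightarrow> ('i \<Rightarrow> 'c \<Rightarrow> 'c) \<Rightarrow>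
   ('i \<Rightarrow> ('b + 'c) option) option \<Rightarrow> ('i \<Rightarrow> ('b + 'c) option) option" where
  "decomposable_Zhat_map J B' C' \<beta> \<gamma> =
     smash_map J (wedge_U B' C') (\<lambda>i. wedge2_map (B' i) (C' i) (\<beta> i) (\<gamma> i))"

definition cartan_summand ::
  "'i set \<Rightarrow> 'i set set \<Rightarrow> ('i \<Rightarrow> 'b pointed) \<Rightarrow> ('i \<Rightarrow> 'c pointed) \<Rightarrow> ('i \<Rightarrow> 'c set) \<Rightarrow> 'i set \<Rightarrow>
   (('i \<Rightarrow> 'c) option \<times> ('i \<Rightarrow> 'b) option) option pointed" where
  "cartan_summand J K B C E I =
     smash2 (Zhat I (full_subcomplex K I) C E)
            (Zhat (J - I) (full_subcomplex K (J - I)) B (\<lambda>j. pts (B j)))"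

definition cartan_wedge ::
  "'i set \<Rightarrow> 'i set set \<Rightarrow> ('i \<Rightarrow> 'b pointed) \<Rightarrow> ('i \<Rightarrow> 'c pointed) \<Rightarrow> ('i \<Rightarrow> 'c set) \<Rightarrow>
   ('i set \<times> (('i \<Rightarrow> 'c) option \<times> ('i \<Rightarrow> 'b) option) option) option pointed" where
  "cartan_wedge J K B C E = wedge (Pow J) (cartan_summand J K B C E)"

definition cartan_wedge_map ::
  "'i set \<Rightarrow> 'i set set \<Rightarrow> ('i \<Rightarrow> 'b pointed) \<Rightarrow> ('i \<Rightarrow> 'c pointed) \<Rightarrow> ('i \<Rightarrow> 'c set) \<Rightarrow>
   ('i \<Rightarrow> 'b \<Rightarrow> 'b) \<Rightarrow> ('i \<Rightarrow> 'c \<Rightarrow> 'c) \<Rightarrow>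
   ('i set \<times> (('i \<Rightarrow> 'c) option \<times> ('i \<Rightarrow> 'b) option) option) option \<Rightarrow>
   ('i set \<times> (('i \<Rightarrow> 'c) option \<times> ('i \<Rightarrow> 'b) option) option) option" where
  "cartan_wedge_map J K B' C' E' \<beta> \<gamma> =
     wedge_map (Pow J) (cartan_summand J K B' C' E')
       (\<lambda>I. smash2_map
          (Zhat I (full_subcomplex K I) C' E')
          (Zhat (J - I) (full_subcomplex K (J - I)) B' (\<lambda>j. pts (B' j)))
          (smash_map I C' \<gamma>) (smash_map (J - I) B' \<beta>))"


section \<open>The topologies above are well defined; conventions for the empty index set\<close>

lemma openin_collapse:
  "openin (spc (collapse X A)) U \<longleftrightarrow>
     U \<subseteq> insert None (Some ` (topspace X - A)) \<and> openin X {x \<in> topspace X. collapse_map A x \<in> U}"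
proof -
  have "istopology (\<lambda>U. U \<subseteq> insert None (Some ` (topspace X - A)) \<and>
                        openin X {x \<in> topspace X. collapse_map A x \<in> U})" (is "istopology ?P")
    unfolding istopology_def
  proof (intro conjI allI impI)
    fix S T assume S: "?P S" and T: "?P T"
    have "{x \<in> topspace X. collapse_map A x \<in> S \<inter> T} =
          {x \<in> topspace X. collapse_map A x \<in> S} \<inter> {x \<in> topspace X. collapse_map A x \<in> T}"
      by blast
    then show "openin X {x \<in> topspace X. collapse_map A x \<in> S \<inter> T}"
      using S T by (simp only: openin_Int)
    show "S \<inter> T \<subseteq> insert None (Some ` (topspace X - A))"
      using S by blast
  next
    fix \<K> assume K: "\<forall>S\<in>\<K>. ?P S"
    have "{x \<in> topspace X. collapse_map A x \<in> \<Union>\<K>} =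
          (\<Union>S\<in>\<K>. {x \<in> topspace X. collapse_map A x \<in> S})"
      by blast
    then show "openin X {x \<in> topspace X. collapse_map A x \<in> \<Union>\<K>}"
      using K by (simp only:) (rule openin_Union, blast)
    show "\<Union>\<K> \<subseteq> insert None (Some ` (topspace X - A))"
      using K by blast
  qed
  then show ?thesis
    by (simp add: collapse_def topology_inverse')
qed

lemma pts_collapse: "pts (collapse X A) = insert None (Some ` (topspace X - A))"
proof -
  have "{x \<in> topspace X. collapse_map A x \<in> insert None (Some ` (topspace X - A))} = topspace X"
    by (auto simp: collapse_map_def)
  then have "openin (spc (collapse X A)) (insert None (Some ` (topspace X - A)))"
    by (simp add: openin_collapse)
  then show ?thesis
    using openin_topspace[of "spc (collapse X A)"]
    by (intro subset_antisym openin_subset) (simp_all only: openin_collapse)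
qed

lemma openin_disjoint_sum:
  "openin (disjoint_sum X Y) U \<longleftrightarrow> openin X (Inl -` U) \<and> openin Y (Inr -` U)"
proof -
  have "istopology (\<lambda>U. openin X (Inl -` U) \<and> openin Y (Inr -` U))"
    by (auto simp: istopology_def vimage_Union)
  then show ?thesis
    by (simp add: disjoint_sum_def topology_inverse')
qed

lemma topspace_disjoint_sum: "topspace (disjoint_sum X Y) = topspace X <+> topspace Y"
proof
  show "topspace (disjoint_sum X Y) \<subseteq> topspace X <+> topspace Y"
  proof
    fix x assume "x \<in> topspace (disjoint_sum X Y)"
    then obtain U where U: "openin (disjoint_sum X Y) U" "x \<in> U"
      by (metis openin_topspace)
    then have "Inl -` U \<subseteq> topspace X" "Inr -` U \<subseteq> topspace Y"
      by (auto simp: openin_disjoint_sum dest: openin_subset)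
    with U(2) show "x \<in> topspace X <+> topspace Y"
      by (cases x) auto
  qed
  have "Inl -` (topspace X <+> topspace Y) = topspace X"
       "Inr -` (topspace X <+> topspace Y) = topspace Y"
    by auto
  then have "openin (disjoint_sum X Y) (topspace X <+> topspace Y)"
    by (simp add: openin_disjoint_sum)
  then show "topspace X <+> topspace Y \<subseteq> topspace (disjoint_sum X Y)"
    by (rule openin_subset)
qed

lemma pts_smash:
  "pts (smash J X) = insert None (Some ` (\<Pi>\<^sub>E i\<in>J. pts (X i) - {pt (X i)}))"
proof -
  have "(\<Pi>\<^sub>E i\<in>J. pts (X i)) - fat_wedge J X = (\<Pi>\<^sub>E i\<in>J. pts (X i) - {pt (X i)})"
    unfolding fat_wedge_def PiE_def Pi_def by blast
  then show ?thesis
    by (simp add: smash_def pts_collapse)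
qed

definition sphere0 :: "('i \<Rightarrow> 'a) option pointed" where
  "sphere0 = (discrete_topology {None, Some (\<lambda>_. undefined)}, None)"

lemma smash_empty: "smash {} X = (sphere0 :: ('i \<Rightarrow> 'a) option pointed)"
proof -
  let ?o = "(\<lambda>_. undefined) :: 'i \<Rightarrow> 'a"
  let ?T = "kification (product_topology (\<lambda>i. spc (X i)) {})"
  have T: "topspace ?T = {?o}" and F: "fat_wedge {} X = {}"
    by (simp_all add: fat_wedge_def)
  have pts: "pts (smash {} X) = {None, Some ?o}"
    by (simp add: pts_smash)
  have op: "openin (spc (smash {} X)) {z}" if z: "z \<in> {None, Some ?o}" for z
  proof -
    have "{x \<in> topspace ?T. collapse_map {} x \<in> {z}} = {} \<or>
          {x \<in> topspace ?T. collapse_map {} x \<in> {z}} = topspace ?T"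
      unfolding T by blast
    then have "openin ?T {x \<in> topspace ?T. collapse_map {} x \<in> {z}}"
      by (metis (no_types, lifting) openin_empty openin_topspace)
    moreover have "{z} \<subseteq> insert None (Some ` (topspace ?T - {}))"
      unfolding T using z by blast
    ultimately show ?thesis
      unfolding smash_def F openin_collapse by blast
  qed
  have "spc (smash {} X) = discrete_topology {None, Some ?o}"
    using pts op discrete_topology_unique[of "{None, Some ?o}" "spc (smash {} X)"] by metis
  moreover have "pt (smash {} X) = None"
    by (simp add: smash_def collapse_def)
  ultimately show ?thesis
    unfolding sphere0_def by (simp add: prod_eq_iff)
qed

lemma Zhat_empty:
  assumes "simplicial_complex_on V K"
  shows "Zhat {} (full_subcomplex K {}) X A = sphere0"
proof -
  have "full_subcomplex K {} = {{}}"
    using assms by (auto simp: full_subcomplex_def simplicial_complex_on_def)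
  moreover have "Dhat {} {} X A = pts (smash {} X)"
    by (simp add: Dhat_def smash_empty sphere0_def)
  ultimately have "Zhat {} (full_subcomplex K {}) X A = smash {} X"
    by (simp add: Zhat_def subspace_pointed_def)
  then show ?thesis
    by (simp add: smash_empty)
qed

end

theory Submission
  imports Defs
begin

text \<open>
  A point of \<open>\<And> (B i \<or> C i)\<close> other than the base point is a tuple each of whose coordinates lies
  either in \<open>B i\<close> or in \<open>C i\<close>, but is not a base point. Let \<open>I\<close> be the set of indices of the second
  kind. Sorting the coordinates accordingly identifies the tuple with a point of
  \<open>\<And>\<^sub>I C \<and> \<And>\<^sub>J\<^sub>-\<^sub>I B\<close>. The tuple lies in the polyhedral smash product iff the indices
  outside \<open>V i = B i \<or> E i\<close> form a simplex of \<open>K\<close>; all these indices lie in \<open>I\<close>, so the condition says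
  exactly that the \<open>C\<close>-part lies in the polyhedral smash product of \<open>(C, E)\<close> over the full subcomplex
  on \<open>I\<close>. This gives a pointed bijection \<open>cartan_map\<close> between the two sides, with the inverse
  \<open>cartan_inverse\<close>. It is a homeomorphism, hence a pointed homotopy equivalence, and it is natural
  because maps of decomposable pairs do not change the kind of a coordinate, unless they send it to
  the base point.

  The work is in the topology. The closed sets on both sides are tested on the same spaces,
  the kifications of the products \<open>M I = \<Prod>\<^sub>I C \<times> \<Prod>\<^sub>J\<^sub>-\<^sub>I B\<close>, one for each \<open>I \<subseteq> J\<close>. For the left-hand
  side this holds because the product of the wedges is a finite union of closed copies of the
  products \<open>M I\<close>, and compact sets decompose along this union (\<open>closedin_kification_cover\<close>). For the
  right-hand side it is the fact that, after kification, products of quotient maps are quotient maps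
  (\<open>closedin_kification_prod_final_left\<close>, \<open>closedin_kification_summand\<close>); it applies because smash
  products of Hausdorff spaces are Hausdorff (\<open>Hausdorff_space_smash\<close>). The polyhedral smash products
  are closed subspaces (\<open>closedin_Zhat\<close>), as the subcomplexes \<open>E i\<close> are closed
  (\<open>closedin_cw_subcomplex\<close>), so that passing to them commutes with quotients and kification.
\<close>

section \<open>Subcomplexes are closed\<close>

text \<open>By the weak topology it is enough to intersect with the closure of one cell. That closure is
  contained in the image of a compact disk, and this image lies in the union of the cell
  itself and finitely many cells of lower dimension; hence the intersection is cut out by finitely
  many closures of cells of the subcomplex.\<close>
lemma closedin_cw_subcomplex:
  assumes cw: "cw_structure X \<C> d" and sub: "cw_subcomplex X \<C> A"
  shows "closedin X A"
proof -
  obtain \<D> where D: "\<D> \<subseteq> \<C>" "A = \<Union>\<D>" and Dcl: "\<And>e. e \<in> \<D> \<Longrightarrow> X closure_of e \<subseteq> A"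
    using sub unfolding cw_subcomplex_def by blast
  have H: "Hausdorff_space X" and dis: "disjoint \<C>" and un: "\<Union>\<C> = topspace X"
    using cw by (auto simp: cw_structure_def)
  have AX: "A \<subseteq> topspace X" using D un by blast
  \<comment> \<open>the disk is closed in the cube of side two, which is compact by Tychonoff\<close>
  have disk: "compact_space (disk n)" for n
  proof -
    let ?P = "powertop_real (UNIV :: nat set)"
    let ?E = "topspace (Euclidean_space n)"
    let ?S = "{x \<in> topspace ?P. (\<Sum>i<n. (x i)\<^sup>2) \<in> {..1::real}}"
    have E: "?E = {x. \<forall>i\<ge>n. x i = 0}"
      by (simp add: topspace_Euclidean_space)
    have "continuous_map ?P euclideanreal (\<lambda>x. (\<Sum>i<n. (x i)\<^sup>2))"
      by (intro continuous_intros) auto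
    then have "closedin ?P ?S"
      by (rule closedin_continuous_map_preimage) auto
    then have cl: "closedin ?P (?E \<inter> ?S)"
      by (intro closedin_Int closedin_Euclidean_space)
    have cpt: "compactin ?P (PiE UNIV (\<lambda>_. {-1..1::real}))"
      by (simp add: compactin_PiE)
    have "?E \<inter> ?S \<subseteq> PiE UNIV (\<lambda>_. {-1..1::real})"
    proof
      fix x assume x: "x \<in> ?E \<inter> ?S"
      have "x i \<in> {-1..1}" for i
      proof (cases "i < n")
        case True
        have "(x i)\<^sup>2 \<le> (\<Sum>i<n. (x i)\<^sup>2)"
          using True by (intro member_le_sum) auto
        also have "\<dots> \<le> 1" using x by simp
        finally show ?thesis by (simp add: abs_square_le_1 abs_le_iff)
      next
        case False then show ?thesis using x by (simp add: E)
      qed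
      then show "x \<in> PiE UNIV (\<lambda>_. {-1..1::real})" by auto
    qed
    then have "compactin ?P (?E \<inter> ?S)"
      using cl cpt closed_compactin by blast
    then have "compact_space (subtopology ?P (?E \<inter> ?S))"
      using compactin_subspace by blast
    moreover have "disk n = subtopology ?P (?E \<inter> ?S)"
      unfolding disk_def Euclidean_space_def E
      by (simp add: subtopology_subtopology)
    ultimately show ?thesis by simp
  qed
  have "closedin X (A \<inter> X closure_of e)" if e: "e \<in> \<C>" for e
  proof -
    obtain \<phi> \<F> where \<phi>: "continuous_map (disk (d e)) X \<phi>"
      and hom: "homeomorphic_map (subtopology (disk (d e)) (disk_interior (d e))) (subtopology X e) \<phi>"
      and F: "\<F> \<subseteq> \<C>" "finite \<F>" "\<phi> ` disk_boundary (d e) \<subseteq> \<Union>\<F>"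
      using cw e unfolding cw_structure_def by metis
    have int: "\<phi> ` disk_interior (d e) = e"
      using homeomorphic_imp_surjective_map[OF hom] e un
      by (auto simp: disk_interior_def Int_absorb1)
    have "topspace (disk (d e)) \<subseteq> disk_interior (d e) \<union> disk_boundary (d e)"
      by (auto simp: disk_interior_def disk_boundary_def disk_def)
    then have img: "\<phi> ` topspace (disk (d e)) \<subseteq> \<Union>(insert e \<F>)"
      using int F(3) by blast
    have "closedin X (\<phi> ` topspace (disk (d e)))"
      using disk \<phi> H by (metis compact_space_def compactin_imp_closedin image_compactin)
    moreover have "e \<subseteq> \<phi> ` topspace (disk (d e))"
      using int by (auto simp: disk_interior_def)
    ultimately have cl: "X closure_of e \<subseteq> \<Union>(insert e \<F>)"
      using img by (meson closure_of_minimal order_trans)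
    have "A \<inter> X closure_of e = X closure_of e \<inter> (\<Union>f \<in> insert e \<F> \<inter> \<D>. X closure_of f)" (is "?l = ?r")
    proof
      show "?r \<subseteq> ?l" using Dcl by blast
      show "?l \<subseteq> ?r"
      proof
        fix x assume x: "x \<in> ?l"
        then obtain f g where f: "f \<in> insert e \<F>" "x \<in> f" and g: "g \<in> \<D>" "x \<in> g"
          using cl D(2) by blast
        then have "f = g"
          using dis D(1) F(1) e unfolding disjoint_def by blast
        moreover have "x \<in> X closure_of f"
          using f(2) x F(1) closure_of_subset[of f X] f(1) e un by blast
        ultimately show "x \<in> ?r" using f g x by blast
      qed
    qed
    moreover have "closedin X \<dots>"
      using F(2) by (intro closedin_Int closedin_Union) auto
    ultimately show ?thesis by simp
  qed
  moreover have "\<forall>A\<subseteq>topspace X. (\<forall>e\<in>\<C>. closedin X (A \<inter> X closure_of e)) \<longrightarrow> closedin X A"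
    using cw by (simp add: cw_structure_def)
  ultimately show ?thesis using AX by simp
qed

section \<open>Collapsing a subset\<close>

lemma closedin_collapse:
  "closedin (spc (collapse X A)) T \<longleftrightarrow>
     T \<subseteq> pts (collapse X A) \<and> closedin X {x \<in> topspace X. collapse_map A x \<in> T}"
proof -
  have "{x \<in> topspace X. collapse_map A x \<in> pts (collapse X A) - T} =
        topspace X - {x \<in> topspace X. collapse_map A x \<in> T}"
    by (auto simp: collapse_map_def pts_collapse)
  moreover have "pts (collapse X A) - T \<subseteq> insert None (Some ` (topspace X - A))"
    by (auto simp: pts_collapse)
  moreover have "{x \<in> topspace X. collapse_map A x \<in> T} \<subseteq> topspace X"
    by blast
  ultimately show ?thesis
    unfolding closedin_def openin_collapse by (simp only: simp_thms)
qed

lemma pt_collapse [simp]: "pt (collapse X A) = None"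
  by (simp add: collapse_def)

lemma continuous_map_collapse_map: "continuous_map X (spc (collapse X A)) (collapse_map A)"
  unfolding continuous_map_closedin closedin_collapse pts_collapse
  by (auto simp: collapse_map_def)

text \<open>The value at \<open>None\<close> has to be mentioned separately because the base point is not hit by the
  collapsing map when the empty set is collapsed.\<close>
lemma continuous_map_from_collapse:
  assumes "continuous_map X Y (g \<circ> collapse_map A)" "g None \<in> topspace Y"
  shows "continuous_map (spc (collapse X A)) Y g"
  unfolding continuous_map_closedin
proof (intro conjI allI impI)
  have *: "g (collapse_map A x) \<in> topspace Y" if "x \<in> topspace X" for x
    using assms(1) that by (auto simp: continuous_map_def Pi_iff)
  show "g \<in> pts (collapse X A) \<rightarrow> topspace Y"
    using * assms(2) by (fastforce simp: pts_collapse collapse_map_def)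
  fix C assume "closedin Y C"
  then have "closedin X {x \<in> topspace X. (g \<circ> collapse_map A) x \<in> C}"
    using assms(1) by (simp add: continuous_map_closedin)
  moreover have "{x \<in> topspace X. (g \<circ> collapse_map A) x \<in> C} =
    {x \<in> topspace X. collapse_map A x \<in> {z \<in> pts (collapse X A). g z \<in> C}}"
    by (auto simp: pts_collapse collapse_map_def)
  ultimately show "closedin (spc (collapse X A)) {z \<in> pts (collapse X A). g z \<in> C}"
    by (simp add: closedin_collapse)
qed

text \<open>Points outside the collapsed set are separated from each other inside the open complement of the
  set, and from the base point by the assumed neighbourhoods.\<close>
lemma Hausdorff_space_collapse:
  assumes X: "Hausdorff_space X"
    and sep: "\<And>x. x \<in> topspace X - A \<Longrightarrow> \<exists>U V. openin X U \<and> openin X V \<and> x \<in> U \<and> A \<inter> topspace X \<subseteq> V \<and> disjnt U V"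
  shows "Hausdorff_space (spc (collapse X A))"
proof -
  have emb: "openin (spc (collapse X A)) (Some ` U)" if U: "openin X U" "U \<inter> A = {}" for U
  proof -
    have "{x \<in> topspace X. collapse_map A x \<in> Some ` U} = U"
      using U openin_subset[OF U(1)] by (auto simp: collapse_map_def)
    then show ?thesis
      using U openin_subset[OF U(1)] by (auto simp: openin_collapse)
  qed
  have away: "\<exists>U. openin X U \<and> x \<in> U \<and> U \<inter> A = {}" if x: "x \<in> topspace X - A" for x
  proof -
    obtain U V where UV: "openin X U" "x \<in> U" "A \<inter> topspace X \<subseteq> V" "disjnt U V"
      using sep[OF x] by blast
    then have "U \<inter> A = {}"
      using openin_subset[OF UV(1)] by (auto simp: disjnt_iff)
    then show ?thesis using UV by blast
  qed
  have none: "\<exists>U V. openin (spc (collapse X A)) U \<and> openin (spc (collapse X A)) V \<and> Some x \<in> U \<and> None \<in> V \<and> disjnt U V"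
    if x: "x \<in> topspace X - A" for x
  proof -
    obtain U V where UV: "openin X U" "openin X V" "x \<in> U" "A \<inter> topspace X \<subseteq> V" "disjnt U V"
      using sep[OF x] by blast
    have "U \<inter> A = {}"
      using UV openin_subset[OF UV(1)] by (auto simp: disjnt_iff)
    moreover have "openin (spc (collapse X A)) (insert None (Some ` (V - A)))"
    proof -
      have "{x \<in> topspace X. collapse_map A x \<in> insert None (Some ` (V - A))} = V"
        using UV openin_subset[OF UV(2)] by (auto simp: collapse_map_def)
      then show ?thesis
        using UV openin_subset[OF UV(2)] by (auto simp: openin_collapse)
    qed
    ultimately show ?thesis
      using emb[OF UV(1)] UV by (intro exI[of _ "Some ` U"] exI[of _ "insert None (Some ` (V - A))"])
        (auto simp: disjnt_iff)
  qed
  have some: "\<exists>U V. openin (spc (collapse X A)) U \<and> openin (spc (collapse X A)) V \<and> Some x \<in> U \<and> Some y \<in> V \<and> disjnt U V"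
    if x: "x \<in> topspace X - A" and y: "y \<in> topspace X - A" and ne: "x \<noteq> y" for x y
  proof -
    obtain U V where UV: "openin X U" "openin X V" "x \<in> U" "y \<in> V" "disjnt U V"
      using X x y ne unfolding Hausdorff_space_def by (meson DiffD1)
    obtain U' where U': "openin X U'" "x \<in> U'" "U' \<inter> A = {}"
      using away[OF x] by blast
    obtain V' where V': "openin X V'" "y \<in> V'" "V' \<inter> A = {}"
      using away[OF y] by blast
    have "openin (spc (collapse X A)) (Some ` (U \<inter> U'))" "openin (spc (collapse X A)) (Some ` (V \<inter> V'))"
      using UV(1,2) U'(1,3) V'(1,3) by (blast intro: emb openin_Int)+
    moreover have "disjnt (Some ` (U \<inter> U')) (Some ` (V \<inter> V'))"
      using UV(5) by (auto simp: disjnt_iff)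
    moreover have "Some x \<in> Some ` (U \<inter> U')" "Some y \<in> Some ` (V \<inter> V')"
      using UV(3,4) U'(2) V'(2) by auto
    ultimately show ?thesis by blast
  qed
  show ?thesis
    unfolding Hausdorff_space_def
  proof (intro allI impI)
    fix z w assume zw: "z \<in> pts (collapse X A) \<and> w \<in> pts (collapse X A) \<and> z \<noteq> w"
    have mem: "y \<in> topspace X - A" if "Some y \<in> pts (collapse X A)" for y
      using that by (auto simp: pts_collapse)
    show "\<exists>U V. openin (spc (collapse X A)) U \<and> openin (spc (collapse X A)) V \<and> z \<in> U \<and> w \<in> V \<and> disjnt U V"
    proof (cases z)
      case None
      then obtain y where w: "w = Some y" using zw by (cases w) auto
      then have "y \<in> topspace X - A" using zw mem by simp
      from none[OF this] show ?thesis unfolding None w by (metis disjnt_sym)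
    next
      case z: (Some x)
      then have x: "x \<in> topspace X - A" using zw mem by simp
      show ?thesis
      proof (cases w)
        case None
        show ?thesis using none[OF x] unfolding None z .
      next
        case w: (Some y)
        then have "y \<in> topspace X - A" "x \<noteq> y" using zw mem z by auto
        then show ?thesis using some[OF x] unfolding w z by simp
      qed
    qed
  qed
qed

section \<open>Products of quotient maps after kification\<close>

lemma Hausdorff_space_kification: "Hausdorff_space X \<Longrightarrow> Hausdorff_space (kification X)"
  by (auto intro: Hausdorff_space_expansive openin_kification_finer)

text \<open>A compact set meets a closed subspace in a compact set, so both topologies are tested by the same
  compact sets.\<close>
lemma closedin_kification_subtopology:
  assumes S: "closedin X S" and T: "T \<subseteq> S"
  shows "closedin (kification (subtopology X S)) T \<longleftrightarrow> closedin (kification X) T"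
proof
  assume L: "closedin (kification (subtopology X S)) T"
  show "closedin (kification X) T"
    unfolding closedin_kification
  proof (intro conjI allI impI)
    show "T \<subseteq> topspace X" using S T closedin_subset by blast
    fix C assume C: "compactin X C"
    have "compactin (subtopology X S) (C \<inter> S)"
      using C S by (simp add: compactin_subtopology compact_Int_closedin)
    then have "closedin (subtopology (subtopology X S) (C \<inter> S)) (C \<inter> S \<inter> T)"
      using L by (simp add: closedin_kification)
    moreover have "subtopology (subtopology X S) (C \<inter> S) = subtopology (subtopology X C) (C \<inter> S)"
      by (simp add: subtopology_subtopology inf_aci)
    moreover have "C \<inter> S \<inter> T = C \<inter> T" using T by blast
    moreover have "closedin (subtopology X C) (C \<inter> S)"
      using S by (auto simp: closedin_subtopology)
    ultimately show "closedin (subtopology X C) (C \<inter> T)"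
      by (metis closedin_trans_full)
  qed
next
  assume R: "closedin (kification X) T"
  have "continuous_map (kification (subtopology X S)) (kification X) id"
    by (intro continuous_map_kification continuous_map_from_subtopology) simp
  then have "closedin (kification (subtopology X S)) {x \<in> topspace (subtopology X S). x \<in> T}"
    using R unfolding continuous_map_closedin by simp
  moreover have "{x \<in> topspace (subtopology X S). x \<in> T} = T"
    using T R closedin_subset[OF R] by auto
  ultimately show "closedin (kification (subtopology X S)) T" by simp
qed

text \<open>The product of a quotient map with a Hausdorff space is a quotient map in the category of
  \<open>k\<close>-spaces. A compact set of \<open>Y \<times> Z\<close> projects to a compact Hausdorff, hence locally compact,
  subspace \<open>L\<close> of \<open>Z\<close>; over \<open>L\<close> Whitehead's theorem on products of quotient maps applies, and
  \<open>X \<times> L\<close> is already a \<open>k\<close>-space, so that closed sets there and in the kification agree.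
  The quotient map may miss the single point \<open>y0\<close>, as the collapse of the empty set misses the
  base point; the fibre over \<open>y0\<close> then carries no condition and has to be closed by assumption.\<close>
lemma closedin_kification_prod_final_left:
  assumes f: "continuous_map X Y f"
    and final: "\<And>T. T \<subseteq> topspace Y \<Longrightarrow> closedin X {x \<in> topspace X. f x \<in> T} \<Longrightarrow> closedin Y T"
    and X: "k_space X" and Z: "Hausdorff_space Z"
    and T: "T \<subseteq> topspace Y \<times> topspace Z"
    and miss: "topspace Y \<subseteq> insert y0 (f ` topspace X)"
    and slice: "closedin Z {z \<in> topspace Z. (y0, z) \<in> T}"
    and cl: "closedin (kification (prod_topology X Z)) {p \<in> topspace X \<times> topspace Z. (f (fst p), snd p) \<in> T}"
  shows "closedin (kification (prod_topology Y Z)) T"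
  unfolding closedin_kification
proof (intro conjI allI impI)
  show "T \<subseteq> topspace (prod_topology Y Z)" using T by simp
  fix C assume C: "compactin (prod_topology Y Z) C"
  define L where "L = snd ` C"
  define R where "R = f ` topspace X"
  have Lc: "compactin Z L"
    unfolding L_def using C continuous_map_snd by (rule image_compactin)
  then have Lcl: "closedin Z L" and LZ: "L \<subseteq> topspace Z"
    using Z by (auto intro: compactin_imp_closedin dest: compactin_subset_topspace)
  let ?Z = "subtopology Z L"
  have loc: "locally_compact_space ?Z" "Hausdorff_space ?Z"
    using Lc Z by (auto intro: compact_imp_locally_compact_space Hausdorff_space_subtopology compact_space_subtopology)
  have RY: "R \<subseteq> topspace Y"
    using f by (auto simp: R_def continuous_map_def)
  have Rcl: "closedin Y R"
  proof (rule final[OF RY])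
    have "{x \<in> topspace X. f x \<in> R} = topspace X" by (auto simp: R_def)
    then show "closedin X {x \<in> topspace X. f x \<in> R}" by simp
  qed
  \<comment> \<open>away from the image every set is closed, since its preimage is empty\<close>
  have off: "closedin Y S" if "S \<subseteq> topspace Y - R" for S
  proof (rule final)
    have "{x \<in> topspace X. f x \<in> S} = {}" using that by (auto simp: R_def)
    then show "closedin X {x \<in> topspace X. f x \<in> S}" by (simp only: closedin_empty)
  qed (use that in blast)
  have q: "quotient_map X (subtopology Y R) f"
    unfolding quotient_map_closedin
  proof (intro conjI allI impI)
    show "f ` topspace X = topspace (subtopology Y R)"
      using RY by (auto simp: R_def)
    fix U assume U: "U \<subseteq> topspace (subtopology Y R)"
    have "closedin X {x \<in> topspace X. f x \<in> U} \<longleftrightarrow> closedin Y U"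
      using final[of U] f U by (auto simp: continuous_map_closedin)
    also have "\<dots> \<longleftrightarrow> closedin (subtopology Y R) U"
      using U Rcl closedin_closed_subtopology by auto
    finally show "closedin X {x \<in> topspace X. f x \<in> U} \<longleftrightarrow> closedin (subtopology Y R) U" .
  qed
  have on: "closedin (prod_topology (subtopology Y R) ?Z) (T \<inter> R \<times> L)"
  proof -
    have qp: "quotient_map (prod_topology X ?Z) (prod_topology (subtopology Y R) ?Z) (\<lambda>(x, y). (f x, y))"
      using loc q by (intro quotient_map_prod_left) auto
    have k: "k_space (prod_topology X ?Z)"
      using X loc by (intro k_space_prod_topology_right) auto
    have "continuous_map (prod_topology X ?Z) (prod_topology X Z) id"
      unfolding prod_topology_subtopology by (intro continuous_map_from_subtopology) simp
    then have "continuous_map (prod_topology X ?Z) (kification (prod_topology X Z)) id"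
      using k by (simp add: continuous_map_into_kification)
    then have "closedin (prod_topology X ?Z) {p \<in> topspace (prod_topology X ?Z).
       id p \<in> {p \<in> topspace X \<times> topspace Z. (f (fst p), snd p) \<in> T}}"
      using cl by (rule closedin_continuous_map_preimage)
    moreover have "{p \<in> topspace (prod_topology X ?Z).
       id p \<in> {p \<in> topspace X \<times> topspace Z. (f (fst p), snd p) \<in> T}} =
       {p \<in> topspace (prod_topology X ?Z). (\<lambda>(x, y). (f x, y)) p \<in> T \<inter> R \<times> L}"
      by (auto simp: R_def)
    moreover have "T \<inter> R \<times> L \<subseteq> topspace (prod_topology (subtopology Y R) ?Z)"
      using RY LZ by auto
    moreover have "closedin (prod_topology X ?Z)
        {p. p \<in> topspace (prod_topology X ?Z) \<and> (\<lambda>(x, y). (f x, y)) p \<in> T \<inter> R \<times> L} \<longleftrightarrow>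
      closedin (prod_topology (subtopology Y R) ?Z) (T \<inter> R \<times> L)"
      if "T \<inter> R \<times> L \<subseteq> topspace (prod_topology (subtopology Y R) ?Z)"
      using qp that unfolding quotient_map_closedin by (elim conjE allE impE)
    ultimately show ?thesis by (simp only:)
  qed
  have "closedin (prod_topology Y Z) (T \<inter> R \<times> L)"
  proof -
    have "prod_topology (subtopology Y R) ?Z = subtopology (prod_topology Y Z) (R \<times> L)"
      by (simp add: subtopology_Times)
    moreover have "closedin (prod_topology Y Z) (R \<times> L)"
      using Rcl Lcl by (simp add: closedin_prod_Times_iff)
    ultimately show ?thesis
      using on closedin_trans_full by metis
  qed
  moreover have "closedin (prod_topology Y Z) ((topspace Y - R) \<times> ({z \<in> topspace Z. (y0, z) \<in> T} \<inter> L))"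
    using off[of "topspace Y - R"] closedin_Int[OF slice Lcl] by (simp add: closedin_prod_Times_iff)
  ultimately have "closedin (prod_topology Y Z) ((T \<inter> R \<times> L) \<union> (topspace Y - R) \<times> ({z \<in> topspace Z. (y0, z) \<in> T} \<inter> L))"
    by (rule closedin_Un)
  moreover have "(T \<inter> R \<times> L) \<union> (topspace Y - R) \<times> ({z \<in> topspace Z. (y0, z) \<in> T} \<inter> L) = T \<inter> (topspace Y \<times> L)"
    using miss LZ RY unfolding R_def by blast
  moreover have "C \<inter> T = (T \<inter> (topspace Y \<times> L)) \<inter> C"
    using T unfolding L_def by force
  ultimately show "closedin (subtopology (prod_topology Y Z) C) (C \<inter> T)"
    by (auto simp: closedin_subtopology)
qed

lemma closedin_kification_prod_final_right:
  assumes f: "continuous_map X Y f"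
    and final: "\<And>T. T \<subseteq> topspace Y \<Longrightarrow> closedin X {x \<in> topspace X. f x \<in> T} \<Longrightarrow> closedin Y T"
    and X: "k_space X" and Z: "Hausdorff_space Z"
    and T: "T \<subseteq> topspace Z \<times> topspace Y"
    and miss: "topspace Y \<subseteq> insert y0 (f ` topspace X)"
    and slice: "closedin Z {z \<in> topspace Z. (z, y0) \<in> T}"
    and cl: "closedin (kification (prod_topology Z X)) {p \<in> topspace Z \<times> topspace X. (fst p, f (snd p)) \<in> T}"
  shows "closedin (kification (prod_topology Z Y)) T"
proof -
  have swap: "continuous_map (kification (prod_topology U V)) (kification (prod_topology V U)) prod.swap"
    for U :: "'x topology" and V :: "'y topology"
    by (intro continuous_map_kification) (simp add: continuous_map_pairwise o_def continuous_map_fst continuous_map_snd)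
  have "closedin (kification (prod_topology Y Z)) (prod.swap ` T)"
  proof (rule closedin_kification_prod_final_left[where X = X and f = f])
    show "closedin (kification (prod_topology X Z)) {p \<in> topspace X \<times> topspace Z. (f (fst p), snd p) \<in> prod.swap ` T}"
    proof -
      have "closedin (kification (prod_topology X Z)) {p \<in> topspace (kification (prod_topology X Z)).
          prod.swap p \<in> {p \<in> topspace Z \<times> topspace X. (fst p, f (snd p)) \<in> T}}"
        using swap cl by (rule closedin_continuous_map_preimage)
      moreover have "{p \<in> topspace (kification (prod_topology X Z)).
          prod.swap p \<in> {p \<in> topspace Z \<times> topspace X. (fst p, f (snd p)) \<in> T}} =
          {p \<in> topspace X \<times> topspace Z. (f (fst p), snd p) \<in> prod.swap ` T}"
        by (auto simp: pair_in_swap_image)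
      ultimately show ?thesis by simp
    qed
    show "prod.swap ` T \<subseteq> topspace Y \<times> topspace Z"
      using T by auto
    show "closedin Z {z \<in> topspace Z. (y0, z) \<in> prod.swap ` T}"
      using slice by (simp add: pair_in_swap_image)
  qed (fact f final X Z miss)+
  then have "closedin (kification (prod_topology Z Y)) {p \<in> topspace (kification (prod_topology Z Y)). prod.swap p \<in> prod.swap ` T}"
    by (rule closedin_continuous_map_preimage[OF swap])
  moreover have "{p \<in> topspace (kification (prod_topology Z Y)). prod.swap p \<in> prod.swap ` T} = T"
    using T by (auto simp: pair_in_swap_image)
  ultimately show ?thesis by simp
qed

section \<open>Wedges and smash products\<close>

lemma pt_smash [simp]: "pt (smash J X) = None"
  and pt_smash2 [simp]: "pt (smash2 Y Z) = None"
  and pt_wedge [simp]: "pt (wedge J X) = None"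
  and pt_wedge2 [simp]: "pt (wedge2 Y Z) = None"
  by (simp_all add: smash_def smash2_def wedge_def wedge2_def)

lemma pt_subspace_pointed [simp]: "pt (subspace_pointed X A) = pt X"
  and pts_subspace_pointed [simp]: "pts (subspace_pointed X A) = pts X \<inter> A"
  by (simp_all add: subspace_pointed_def)

lemma pt_Zhat [simp]: "pt (Zhat J K X A) = None"
  by (simp add: Zhat_def)

abbreviation inl :: "'b pointed \<Rightarrow> 'c pointed \<Rightarrow> 'b \<Rightarrow> ('b + 'c) option" where
  "inl Y Z b \<equiv> collapse_map {Inl (pt Y), Inr (pt Z)} (Inl b)"

abbreviation inr :: "'b pointed \<Rightarrow> 'c pointed \<Rightarrow> 'c \<Rightarrow> ('b + 'c) option" where
  "inr Y Z c \<equiv> collapse_map {Inl (pt Y), Inr (pt Z)} (Inr c)"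

definition pinchl :: "'b \<Rightarrow> ('b + 'c) option \<Rightarrow> 'b" where
  "pinchl b0 z = (case z of Some (Inl b) \<Rightarrow> b | _ \<Rightarrow> b0)"

definition pinchr :: "'c \<Rightarrow> ('b + 'c) option \<Rightarrow> 'c" where
  "pinchr c0 z = (case z of Some (Inr c) \<Rightarrow> c | _ \<Rightarrow> c0)"

lemma continuous_map_disjoint_sum:
  "continuous_map (disjoint_sum X Y) Z g \<longleftrightarrow> continuous_map X Z (g \<circ> Inl) \<and> continuous_map Y Z (g \<circ> Inr)"
proof -
  have "Inl -` {x \<in> topspace (disjoint_sum X Y). g x \<in> U} = {x \<in> topspace X. g (Inl x) \<in> U}"
       "Inr -` {x \<in> topspace (disjoint_sum X Y). g x \<in> U} = {x \<in> topspace Y. g (Inr x) \<in> U}" for U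
    by (auto simp: topspace_disjoint_sum)
  moreover have "g \<in> topspace (disjoint_sum X Y) \<rightarrow> topspace Z \<longleftrightarrow>
     g \<circ> Inl \<in> topspace X \<rightarrow> topspace Z \<and> g \<circ> Inr \<in> topspace Y \<rightarrow> topspace Z"
    by (auto simp: topspace_disjoint_sum)
  ultimately show ?thesis
    unfolding continuous_map_def openin_disjoint_sum by auto
qed

lemma pts_wedge2:
  "pts (wedge2 Y Z) = insert None (Some ` ((pts Y - {pt Y}) <+> (pts Z - {pt Z})))"
  by (auto simp: wedge2_def pts_collapse topspace_disjoint_sum)

lemma continuous_map_inl: "continuous_map (spc Y) (spc (wedge2 Y Z)) (inl Y Z)"
  and continuous_map_inr: "continuous_map (spc Z) (spc (wedge2 Y Z)) (inr Y Z)"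
proof -
  have "continuous_map (disjoint_sum (spc Y) (spc Z)) (disjoint_sum (spc Y) (spc Z)) id"
    by simp
  then have *: "continuous_map (spc Y) (disjoint_sum (spc Y) (spc Z)) Inl"
      "continuous_map (spc Z) (disjoint_sum (spc Y) (spc Z)) Inr"
    unfolding continuous_map_disjoint_sum by simp_all
  show "continuous_map (spc Y) (spc (wedge2 Y Z)) (inl Y Z)"
    using continuous_map_compose[OF *(1) continuous_map_collapse_map]
    by (simp add: wedge2_def o_def)
  show "continuous_map (spc Z) (spc (wedge2 Y Z)) (inr Y Z)"
    using continuous_map_compose[OF *(2) continuous_map_collapse_map]
    by (simp add: wedge2_def o_def)
qed

text \<open>The two pinch maps split the wedge off its summands; together they map it injectively to
  the product, which makes it Hausdorff.\<close>
lemma continuous_map_pinch: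
  assumes "pt Y \<in> pts Y" "pt Z \<in> pts Z"
  shows continuous_map_pinchl: "continuous_map (spc (wedge2 Y Z)) (spc Y) (pinchl (pt Y))"
    and continuous_map_pinchr: "continuous_map (spc (wedge2 Y Z)) (spc Z) (pinchr (pt Z))"
proof -
  let ?A = "{Inl (pt Y), Inr (pt Z)}"
  have l: "(pinchl (pt Y) \<circ> collapse_map ?A) \<circ> Inl = id" "(pinchl (pt Y) \<circ> collapse_map ?A) \<circ> Inr = (\<lambda>_. pt Y)"
    and r: "(pinchr (pt Z) \<circ> collapse_map ?A) \<circ> Inr = id" "(pinchr (pt Z) \<circ> collapse_map ?A) \<circ> Inl = (\<lambda>_. pt Z)"
    by (auto simp: fun_eq_iff pinchl_def pinchr_def collapse_map_def)
  show "continuous_map (spc (wedge2 Y Z)) (spc Y) (pinchl (pt Y))"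
    unfolding wedge2_def
    by (rule continuous_map_from_collapse)
      (use assms in \<open>simp_all only: continuous_map_disjoint_sum l, simp_all add: pinchl_def\<close>)
  show "continuous_map (spc (wedge2 Y Z)) (spc Z) (pinchr (pt Z))"
    unfolding wedge2_def
    by (rule continuous_map_from_collapse)
      (use assms in \<open>simp_all only: continuous_map_disjoint_sum r, simp_all add: pinchr_def\<close>)
qed

lemma Hausdorff_space_wedge2:
  assumes "pt Y \<in> pts Y" "pt Z \<in> pts Z" "Hausdorff_space (spc Y)" "Hausdorff_space (spc Z)"
  shows "Hausdorff_space (spc (wedge2 Y Z))"
proof (rule Hausdorff_space_injective_preimage)
  show "continuous_map (spc (wedge2 Y Z)) (prod_topology (spc Y) (spc Z)) (\<lambda>z. (pinchl (pt Y) z, pinchr (pt Z) z))"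
    using continuous_map_pinch[OF assms(1,2)] by (rule continuous_map_pairedI)
  show "inj_on (\<lambda>z. (pinchl (pt Y) z, pinchr (pt Z) z)) (pts (wedge2 Y Z))"
    by (auto simp: inj_on_def pts_wedge2 pinchl_def pinchr_def)
qed (use assms in \<open>simp add: Hausdorff_space_prod_topology\<close>)

lemma fat_wedge_Un:
  "fat_wedge J X = (\<Union>i\<in>J. {x \<in> topspace (product_topology (\<lambda>i. spc (X i)) J). x i \<in> {pt (X i)}})"
  by (auto simp: fat_wedge_def)

text \<open>The fat wedge is a finite union of preimages of base points under the coordinate maps.\<close>
lemma closedin_fat_wedge:
  assumes "finite J" "\<And>i. i \<in> J \<Longrightarrow> Hausdorff_space (spc (X i)) \<and> pt (X i) \<in> pts (X i)"
  shows "closedin (product_topology (\<lambda>i. spc (X i)) J) (fat_wedge J X)"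
  unfolding fat_wedge_Un
proof (intro closedin_Union finite_imageI \<open>finite J\<close>; clarify)
  fix i assume "i \<in> J"
  then show "closedin (product_topology (\<lambda>i. spc (X i)) J)
    {x \<in> topspace (product_topology (\<lambda>i. spc (X i)) J). x i \<in> {pt (X i)}}"
    using assms(2)[of i]
    by (intro closedin_continuous_map_preimage[OF continuous_map_product_coordinates])
      (auto intro: closedin_Hausdorff_singleton)
qed

text \<open>Disjoint neighbourhoods of each coordinate of \<open>x\<close> and of the base point yield a box around \<open>x\<close>
  and a union of slabs around the fat wedge. Finiteness of \<open>J\<close> makes the box open.\<close>
lemma Hausdorff_space_smash:
  assumes J: "finite J" and X: "\<And>i. i \<in> J \<Longrightarrow> Hausdorff_space (spc (X i)) \<and> pt (X i) \<in> pts (X i)"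
  shows "Hausdorff_space (spc (smash J X))"
  unfolding smash_def
proof (rule Hausdorff_space_collapse)
  let ?P = "product_topology (\<lambda>i. spc (X i)) J"
  have "Hausdorff_space ?P"
    using X by (simp add: Hausdorff_space_product_topology)
  then show "Hausdorff_space (kification ?P)"
    by (rule Hausdorff_space_kification)
  fix x assume "x \<in> topspace (kification ?P) - fat_wedge J X"
  then have x: "x \<in> topspace ?P" and ne: "\<And>i. i \<in> J \<Longrightarrow> x i \<noteq> pt (X i)"
    by (auto simp: fat_wedge_def)
  have "\<exists>U V. openin (spc (X i)) U \<and> openin (spc (X i)) V \<and> x i \<in> U \<and> pt (X i) \<in> V \<and> disjnt U V" if "i \<in> J" for i
    using X[OF that] ne[OF that] x that unfolding Hausdorff_space_def by (auto simp: PiE_iff)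
  then obtain U V where UV: "\<And>i. i \<in> J \<Longrightarrow> openin (spc (X i)) (U i) \<and> openin (spc (X i)) (V i) \<and>
      x i \<in> U i \<and> pt (X i) \<in> V i \<and> disjnt (U i) (V i)"
    by metis
  let ?U = "\<Pi>\<^sub>E i\<in>J. U i"
  let ?V = "\<Union>i\<in>J. {y \<in> topspace ?P. y i \<in> V i}"
  have "openin ?P ?U"
    using J UV by (auto simp: openin_PiE_gen)
  moreover have "openin ?P ?V"
  proof (rule openin_Union, clarify)
    fix i assume "i \<in> J"
    then show "openin ?P {y \<in> topspace ?P. y i \<in> V i}"
      using UV by (intro openin_continuous_map_preimage[OF continuous_map_product_coordinates]) auto
  qed
  moreover have "x \<in> ?U" using x UV by (auto simp: PiE_iff)
  moreover have "fat_wedge J X \<inter> topspace (kification ?P) \<subseteq> ?V"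
    using UV by (auto simp: fat_wedge_def)
  moreover have "disjnt ?U ?V"
    using UV by (fastforce simp: disjnt_iff PiE_iff)
  ultimately show "\<exists>U V. openin (kification ?P) U \<and> openin (kification ?P) V \<and> x \<in> U \<and>
      fat_wedge J X \<inter> topspace (kification ?P) \<subseteq> V \<and> disjnt U V"
    by (meson openin_kification_finer)
qed

section \<open>Polyhedral smash products\<close>

lemma Dhat_union_iff:
  assumes K: "K \<noteq> {}" and A: "\<And>i. i \<in> J \<Longrightarrow> A i \<subseteq> pts (X i)"
  shows "None \<in> (\<Union>\<sigma>\<in>K. Dhat J \<sigma> X A)"
    and "Some x \<in> (\<Union>\<sigma>\<in>K. Dhat J \<sigma> X A) \<longleftrightarrow>
       x \<in> (\<Pi>\<^sub>E i\<in>J. pts (X i) - {pt (X i)}) \<and> (\<exists>\<sigma>\<in>K. \<forall>i\<in>J - \<sigma>. x i \<in> A i)"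
proof -
  show "None \<in> (\<Union>\<sigma>\<in>K. Dhat J \<sigma> X A)"
    using K by (auto simp: Dhat_def pts_smash)
  have "Some x \<in> Dhat J \<sigma> X A \<longleftrightarrow> x \<in> (\<Pi>\<^sub>E i\<in>J. pts (X i) - {pt (X i)}) \<and> (\<forall>i\<in>J - \<sigma>. x i \<in> A i)" for \<sigma>
    using A by (auto simp: Dhat_def pts_smash PiE_iff split: if_splits)
  then show "Some x \<in> (\<Union>\<sigma>\<in>K. Dhat J \<sigma> X A) \<longleftrightarrow>
       x \<in> (\<Pi>\<^sub>E i\<in>J. pts (X i) - {pt (X i)}) \<and> (\<exists>\<sigma>\<in>K. \<forall>i\<in>J - \<sigma>. x i \<in> A i)"
    by auto
qed

lemma Dhat_subset:
  assumes "\<And>i. i \<in> J \<Longrightarrow> A i \<subseteq> pts (X i)"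
  shows "(\<Union>\<sigma>\<in>K. Dhat J \<sigma> X A) \<subseteq> pts (smash J X)"
  using assms by (auto simp: Dhat_def pts_smash PiE_iff)

lemma pts_Zhat:
  assumes "\<And>i. i \<in> J \<Longrightarrow> A i \<subseteq> pts (X i)"
  shows "pts (Zhat J K X A) = (\<Union>\<sigma>\<in>K. Dhat J \<sigma> X A)"
  using Dhat_subset[of J A X K, OF assms] by (simp add: Zhat_def Int_absorb1)

lemma collapse_fat_wedge_in_Zhat_iff:
  assumes K: "K \<noteq> {}" and A: "\<And>i. i \<in> J \<Longrightarrow> A i \<subseteq> pts (X i)"
    and x: "x \<in> topspace (product_topology (\<lambda>i. spc (X i)) J)"
  shows "collapse_map (fat_wedge J X) x \<in> (\<Union>\<sigma>\<in>K. Dhat J \<sigma> X A) \<longleftrightarrow>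
     x \<in> fat_wedge J X \<or> (\<exists>\<sigma>\<in>K. \<forall>i\<in>J - \<sigma>. x i \<in> A i)"
proof (cases "x \<in> fat_wedge J X")
  case True
  then show ?thesis
    using Dhat_union_iff(1)[where J = J and A = A and X = X, OF K A]
    by (simp add: collapse_map_def del: UN_iff)
next
  case False
  then have "x \<in> (\<Pi>\<^sub>E i\<in>J. pts (X i) - {pt (X i)})"
    using x by (auto simp: fat_wedge_def PiE_iff)
  then show ?thesis
    using False Dhat_union_iff(2)[where J = J and A = A and X = X and x = x, OF K A]
    by (simp add: collapse_map_def del: UN_iff)
qed

text \<open>Being closed is what makes the subspace topology on the polyhedral smash product compatible with
  the quotient topology of the smash product and with kification.\<close>
lemma closedin_Zhat:
  assumes J: "finite J" and K: "finite K" "K \<noteq> {}"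
    and X: "\<And>i. i \<in> J \<Longrightarrow> Hausdorff_space (spc (X i)) \<and> pt (X i) \<in> pts (X i)"
    and A: "\<And>i. i \<in> J \<Longrightarrow> closedin (spc (X i)) (A i)"
  shows "closedin (spc (smash J X)) (\<Union>\<sigma>\<in>K. Dhat J \<sigma> X A)"
  unfolding smash_def closedin_collapse
proof
  let ?P = "product_topology (\<lambda>i. spc (X i)) J"
  let ?S = "\<Union>\<sigma>\<in>K. Dhat J \<sigma> X A"
  have AX: "\<And>i. i \<in> J \<Longrightarrow> A i \<subseteq> pts (X i)" using A closedin_subset by blast
  show "?S \<subseteq> pts (collapse (kification ?P) (fat_wedge J X))"
    using Dhat_subset[OF AX] by (simp add: smash_def)
  have W: "closedin ?P {x \<in> topspace ?P. \<forall>i\<in>J - \<sigma>. x i \<in> A i}" for \<sigma>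
  proof -
    have "closedin ?P {x \<in> topspace ?P. x i \<in> A i}" if "i \<in> J" for i
      using A[OF that] that
      by (intro closedin_continuous_map_preimage[OF continuous_map_product_coordinates])
    then have "closedin ?P (\<Inter>(insert (topspace ?P) ((\<lambda>i. {x \<in> topspace ?P. x i \<in> A i}) ` (J - \<sigma>))))"
      by (intro closedin_Inter) (blast intro: closedin_topspace)+
    moreover have "\<Inter>(insert (topspace ?P) ((\<lambda>i. {x \<in> topspace ?P. x i \<in> A i}) ` (J - \<sigma>))) =
        {x \<in> topspace ?P. \<forall>i\<in>J - \<sigma>. x i \<in> A i}" by auto
    ultimately show ?thesis by (simp only:)
  qed
  have "{x \<in> topspace ?P. collapse_map (fat_wedge J X) x \<in> ?S} =
     fat_wedge J X \<union> (\<Union>\<sigma>\<in>K. {x \<in> topspace ?P. \<forall>i\<in>J - \<sigma>. x i \<in> A i})" (is "?L = ?R")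
  proof (rule set_eqI)
    fix x
    have "x \<in> fat_wedge J X \<Longrightarrow> x \<in> topspace ?P"
      by (simp add: fat_wedge_def)
    then show "x \<in> ?L \<longleftrightarrow> x \<in> ?R"
      using collapse_fat_wedge_in_Zhat_iff[where J = J and A = A and X = X and x = x, OF K(2) AX] by blast
  qed
  moreover have "closedin ?P ?R"
    using K(1) W closedin_fat_wedge[where J = J, OF J X] by (intro closedin_Un closedin_Union) (assumption, erule finite_imageI, blast)
  ultimately have "closedin ?P {x \<in> topspace ?P. collapse_map (fat_wedge J X) x \<in> ?S}"
    by (simp only:)
  then show "closedin (kification ?P) {x \<in> topspace (kification ?P). collapse_map (fat_wedge J X) x \<in> ?S}"
    unfolding topspace_kification by (rule closedin_kification_finer)
qed

lemma Zhat_self: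
  assumes "K \<noteq> {}"
  shows "Zhat J K X (\<lambda>j. pts (X j)) = smash J X"
proof -
  have "subspace_pointed (X i) (pts (X i)) = X i" for i
    by (simp add: subspace_pointed_def prod_eq_iff)
  then have "Dhat J \<sigma> X (\<lambda>j. pts (X j)) = pts (smash J X)" for \<sigma>
    by (simp add: Dhat_def)
  then show ?thesis
    using assms by (simp add: Zhat_def subspace_pointed_def prod_eq_iff)
qed

section \<open>The decomposition of points\<close>

text \<open>The index set \<open>I\<close> of the summand is read off from the point. A point determines its image
  without reference to the spaces, and this is why the map is natural.\<close>
definition cartan_map ::
  "'i set \<Rightarrow> ('i \<Rightarrow> ('b + 'c) option) option \<Rightarrow> ('i set \<times> (('i \<Rightarrow> 'c) option \<times> ('i \<Rightarrow> 'b) option) option) option" where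
  "cartan_map J z = (case z of None \<Rightarrow> None | Some x \<Rightarrow>
     (let I = {i \<in> J. \<exists>c. x i = Some (Inr c)} in
      Some (I, Some (Some (\<lambda>i\<in>I. projr (the (x i))), Some (\<lambda>j\<in>J - I. projl (the (x j)))))))"

definition cartan_inverse ::
  "'i set \<Rightarrow> ('i set \<times> (('i \<Rightarrow> 'c) option \<times> ('i \<Rightarrow> 'b) option) option) option \<Rightarrow> ('i \<Rightarrow> ('b + 'c) option) option" where
  "cartan_inverse J w = (case w of
     Some (I, Some (Some c, Some b)) \<Rightarrow> Some (\<lambda>i\<in>J. Some (if i \<in> I then Inr (c i) else Inl (b i)))
   | _ \<Rightarrow> None)"

lemma collapse_map_in_pts: "x \<in> topspace X \<Longrightarrow> collapse_map A x \<in> pts (collapse X A)"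
  by (auto simp: pts_collapse collapse_map_def)

section \<open>Closed pieces of the product of the wedges\<close>

text \<open>The point-set content of wedge decomposability. Facts named after a letter are the assumptions
  on the object with that letter.\<close>
locale decomposable_family =
  fixes J :: "'i set" and K :: "'i set set"
    and B :: "'i \<Rightarrow> 'b pointed" and C :: "'i \<Rightarrow> 'c pointed" and E :: "'i \<Rightarrow> 'c set"
  assumes J: "finite J"
    and K: "simplicial_complex_on J K"
    and B: "i \<in> J \<Longrightarrow> Hausdorff_space (spc (B i)) \<and> pt (B i) \<in> pts (B i)"
    and C: "i \<in> J \<Longrightarrow> Hausdorff_space (spc (C i)) \<and> pt (C i) \<in> pts (C i)"
    and E: "i \<in> J \<Longrightarrow> closedin (spc (C i)) (E i) \<and> pt (C i) \<in> E i"
begin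

abbreviation "U \<equiv> wedge_U B C"
abbreviation "V \<equiv> wedge_V B C E"
abbreviation "P \<equiv> product_topology (\<lambda>i. spc (U i)) J"
abbreviation "PC I \<equiv> product_topology (\<lambda>i. spc (C i)) I"
abbreviation "PB I \<equiv> product_topology (\<lambda>i. spc (B i)) (J - I)"
abbreviation "M I \<equiv> prod_topology (PC I) (PB I)"
abbreviation "qU \<equiv> collapse_map (fat_wedge J U)"
abbreviation "qC I \<equiv> collapse_map (fat_wedge I C)"
abbreviation "qB I \<equiv> collapse_map (fat_wedge (J - I) B)"
abbreviation "W I \<equiv> smash (J - I) B"

definition ZU :: "('i \<Rightarrow> ('b + 'c) option) option set" where
  "ZU = (\<Union>\<sigma>\<in>K. Dhat J \<sigma> U V)"

definition ZC :: "'i set \<Rightarrow> ('i \<Rightarrow> 'c) option set" where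
  "ZC I = (\<Union>\<sigma>\<in>full_subcomplex K I. Dhat I \<sigma> C E)"

text \<open>The closed piece of \<open>\<Prod> (B i \<or> C i)\<close> with index set \<open>I\<close> is a copy of the product \<open>M I\<close>,
  embedded by \<open>merge I\<close>.\<close>
definition merge :: "'i set \<Rightarrow> ('i \<Rightarrow> 'c) \<times> ('i \<Rightarrow> 'b) \<Rightarrow> 'i \<Rightarrow> ('b + 'c) option" where
  "merge I p = (\<lambda>i\<in>J. if i \<in> I then inr (B i) (C i) (fst p i) else inl (B i) (C i) (snd p i))"

text \<open>A continuous left inverse of \<open>merge I\<close>, defined on the whole product by pinching each wedge onto
  one of its summands.\<close>
definition split :: "'i set \<Rightarrow> ('i \<Rightarrow> ('b + 'c) option) \<Rightarrow> ('i \<Rightarrow> 'c) \<times> ('i \<Rightarrow> 'b)" where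
  "split I x = (\<lambda>i\<in>I. pinchr (pt (C i)) (x i), \<lambda>j\<in>J - I. pinchl (pt (B j)) (x j))"

text \<open>A pair of points of the two smash factors passes two quotient maps: to the \<open>I\<close>-th summand, and from
  there to the wedge, which identifies the base points \<open>(I, None)\<close> of all summands.\<close>
definition inc :: "'i set \<Rightarrow> ('i \<Rightarrow> 'c) option \<times> ('i \<Rightarrow> 'b) option \<Rightarrow>
    ('i set \<times> (('i \<Rightarrow> 'c) option \<times> ('i \<Rightarrow> 'b) option) option) option" where
  "inc I zw = collapse_map ((\<lambda>I. (I, None)) ` Pow J)
     (I, collapse_map (axes (Zhat I (full_subcomplex K I) C E) (W I)) zw)"

lemma U: "i \<in> J \<Longrightarrow> Hausdorff_space (spc (U i)) \<and> pt (U i) \<in> pts (U i)"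
  using B[of i] C[of i] by (simp add: wedge_U_def Hausdorff_space_wedge2 pts_wedge2)

lemma pt_U [simp]: "pt (U i) = None"
  by (simp add: wedge_U_def)

lemma E_subset: "i \<in> J \<Longrightarrow> E i \<subseteq> pts (C i)"
  using E closedin_subset by blast

text \<open>Membership in \<open>B i \<or> E i\<close> depends only on the projection to \<open>C i\<close>. Closedness of \<open>V i\<close> follows
  by continuity of the pinch map.\<close>
lemma V_iff: "i \<in> J \<Longrightarrow> z \<in> V i \<longleftrightarrow> z \<in> pts (U i) \<and> pinchr (pt (C i)) z \<in> E i"
  using E[of i] E_subset[of i]
  by (auto simp: wedge_V_def wedge_U_def pts_wedge2 pinchr_def split: option.splits sum.splits)

lemma closedin_V: "i \<in> J \<Longrightarrow> closedin (spc (U i)) (V i)"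
proof -
  assume i: "i \<in> J"
  have "continuous_map (spc (U i)) (spc (C i)) (pinchr (pt (C i)))"
    using B[OF i] C[OF i] by (simp add: wedge_U_def continuous_map_pinchr)
  then have "closedin (spc (U i)) {z \<in> pts (U i). pinchr (pt (C i)) z \<in> E i}"
    using E[OF i] by (intro closedin_continuous_map_preimage) auto
  moreover have "{z \<in> pts (U i). pinchr (pt (C i)) z \<in> E i} = V i"
    using V_iff[OF i] by auto
  ultimately show ?thesis by simp
qed

lemma V_subset: "i \<in> J \<Longrightarrow> V i \<subseteq> pts (U i)"
  using V_iff by blast

lemma K_finite: "finite K" "K \<noteq> {}"
  and full_finite: "finite (full_subcomplex K I)" "full_subcomplex K I \<noteq> {}"
proof -
  show "finite K" "K \<noteq> {}"
    using K J finite_subset[of K "Pow J"] by (auto simp: simplicial_complex_on_def)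
  then show "finite (full_subcomplex K I)" "full_subcomplex K I \<noteq> {}"
    using K by (auto simp: full_subcomplex_def simplicial_complex_on_def)
qed

lemma None_in_ZU: "None \<in> ZU"
  unfolding ZU_def by (rule Dhat_union_iff(1)) (use K_finite V_subset in \<open>blast+\<close>)

lemma None_in_ZC: "I \<subseteq> J \<Longrightarrow> None \<in> ZC I"
  unfolding ZC_def by (rule Dhat_union_iff(1)) (use full_finite E_subset in \<open>blast+\<close>)

lemma closedin_ZU: "closedin (spc (smash J U)) ZU"
  unfolding ZU_def using J K_finite U closedin_V by (rule closedin_Zhat)

lemma closedin_ZC: "I \<subseteq> J \<Longrightarrow> closedin (spc (smash I C)) (ZC I)"
  unfolding ZC_def by (rule closedin_Zhat) (use J C E full_finite finite_subset in \<open>blast+\<close>)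

lemma continuous_map_merge: "continuous_map (M I) P (merge I)"
  unfolding continuous_map_componentwise
proof (intro conjI ballI)
  show "merge I ` topspace (M I) \<subseteq> extensional J"
    by (auto simp: merge_def)
  fix i assume i: "i \<in> J"
  show "continuous_map (M I) (spc (U i)) (\<lambda>p. merge I p i)"
  proof (cases "i \<in> I")
    case True
    have "continuous_map (M I) (spc (U i)) (inr (B i) (C i) \<circ> ((\<lambda>c. c i) \<circ> fst))"
      unfolding wedge_U_def
      by (intro continuous_map_compose[OF _ continuous_map_inr]
          continuous_map_compose[OF continuous_map_fst continuous_map_product_coordinates] True)
    then show ?thesis using i True by (simp add: merge_def o_def)
  next
    case False
    have "continuous_map (M I) (spc (U i)) (inl (B i) (C i) \<circ> ((\<lambda>b. b i) \<circ> snd))"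
      unfolding wedge_U_def
      by (intro continuous_map_compose[OF _ continuous_map_inl]
          continuous_map_compose[OF continuous_map_snd continuous_map_product_coordinates]) (use i False in simp)
    then show ?thesis using i False by (simp add: merge_def o_def)
  qed
qed

lemma continuous_map_split:
  assumes I: "I \<subseteq> J"
  shows "continuous_map P (M I) (split I)"
  unfolding split_def
proof (rule continuous_map_pairedI)
  have coord: "continuous_map P (spc (wedge2 (B i) (C i))) (\<lambda>x. x i)" if "i \<in> J" for i
    using continuous_map_product_coordinates[OF that, of "\<lambda>i. spc (U i)"] by (simp add: wedge_U_def)
  show "continuous_map P (PC I) (\<lambda>x. \<lambda>i\<in>I. pinchr (pt (C i)) (x i))"
    unfolding continuous_map_componentwise
  proof (intro conjI ballI)
    fix i assume i: "i \<in> I"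
    then have iJ: "i \<in> J" using I by blast
    have "continuous_map P (spc (C i)) (pinchr (pt (C i)) \<circ> (\<lambda>x. x i))"
      using B[OF iJ] C[OF iJ]
      by (intro continuous_map_compose[OF coord[OF iJ]] continuous_map_pinchr) auto
    then show "continuous_map P (spc (C i)) (\<lambda>x. (\<lambda>i\<in>I. pinchr (pt (C i)) (x i)) i)"
      using i by (simp add: o_def)
  qed auto
  show "continuous_map P (PB I) (\<lambda>x. \<lambda>j\<in>J - I. pinchl (pt (B j)) (x j))"
    unfolding continuous_map_componentwise
  proof (intro conjI ballI)
    fix i assume i: "i \<in> J - I"
    then have iJ: "i \<in> J" by blast
    have "continuous_map P (spc (B i)) (pinchl (pt (B i)) \<circ> (\<lambda>x. x i))"
      using B[OF iJ] C[OF iJ]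
      by (intro continuous_map_compose[OF coord[OF iJ]] continuous_map_pinchl) auto
    then show "continuous_map P (spc (B i)) (\<lambda>x. (\<lambda>j\<in>J - I. pinchl (pt (B j)) (x j)) i)"
      using i by (simp add: o_def)
  qed auto
qed

lemma merge_split:
  assumes x: "x \<in> topspace P"
  shows "merge {i \<in> J. \<exists>c. x i = Some (Inr c)} (split {i \<in> J. \<exists>c. x i = Some (Inr c)} x) = x"
proof
  fix i
  show "merge {i \<in> J. \<exists>c. x i = Some (Inr c)} (split {i \<in> J. \<exists>c. x i = Some (Inr c)} x) i = x i"
  proof (cases "i \<in> J")
    case True
    then have "x i \<in> pts (wedge2 (B i) (C i))"
      using x by (auto simp: wedge_U_def)
    then show ?thesis
      using True by (auto simp: merge_def split_def pts_wedge2 pinchl_def pinchr_def collapse_map_def)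
  next
    case False
    then show ?thesis
      using PiE_arb[of x J "\<lambda>i. pts (U i)" i] x by (simp add: merge_def)
  qed
qed

text \<open>The finitely many pieces \<open>merge I\<close> cover the product. Each is closed, being the set of fixed points
  of the continuous map \<open>merge I \<circ> split I\<close>, so a compact set \<open>L\<close> is a finite union of compact sets,
  one in each piece, and \<open>L \<inter> T\<close> is a finite union of images of compact sets.\<close>
lemma closedin_kification_cover:
  assumes T: "T \<subseteq> topspace P"
    and cl: "\<And>I. I \<subseteq> J \<Longrightarrow> closedin (kification (M I)) {p \<in> topspace (M I). merge I p \<in> T}"
  shows "closedin (kification P) T"
  unfolding closedin_kification
proof (intro conjI allI impI)
  show "T \<subseteq> topspace P" by (fact T)
  fix L assume L: "compactin P L"
  have H: "Hausdorff_space P"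
    using U by (simp add: Hausdorff_space_product_topology)
  \<comment> \<open>\<open>D I\<close> is the image of \<open>merge I\<close>; \<open>N I\<close> is the part of \<open>L \<inter> T\<close> in it, seen in \<open>M I\<close>\<close>
  define D where "D I = {x \<in> topspace P. (merge I \<circ> split I) x = id x}" for I
  define N where "N I = split I ` (L \<inter> D I) \<inter> {p \<in> topspace (M I). merge I p \<in> T}" for I
  have cpt: "compactin P (merge I ` N I)" if I: "I \<subseteq> J" for I
  proof -
    have "closedin P (D I)"
      unfolding D_def
      using H continuous_map_compose[OF continuous_map_split[OF I] continuous_map_merge] continuous_map_id
      by (rule closedin_continuous_maps_eq)
    then have "compactin P (L \<inter> D I)"
      using L compact_Int_closedin by blast
    then have c: "compactin (M I) (split I ` (L \<inter> D I))"
      using continuous_map_split[OF I] by (rule image_compactin)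
    then have "closedin (subtopology (M I) (split I ` (L \<inter> D I))) (N I)"
      using cl[OF I] unfolding N_def closedin_kification by blast
    moreover have "compact_space (subtopology (M I) (split I ` (L \<inter> D I)))"
      using c by (rule compact_space_subtopology)
    ultimately have "compactin (subtopology (M I) (split I ` (L \<inter> D I))) (N I)"
      by (simp only: closedin_compact_space)
    then have "compactin (M I) (N I)"
      by (simp only: compactin_subtopology)
    then show ?thesis
      using continuous_map_merge by (rule image_compactin)
  qed
  have "L \<inter> T = (\<Union>I\<in>Pow J. merge I ` N I)"
  proof
    show "(\<Union>I\<in>Pow J. merge I ` N I) \<subseteq> L \<inter> T"
      by (auto simp: N_def D_def)
    show "L \<inter> T \<subseteq> (\<Union>I\<in>Pow J. merge I ` N I)"
    proof
      fix x assume x: "x \<in> L \<inter> T"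
      then have xP: "x \<in> topspace P" using T by blast
      define I where "I = {i \<in> J. \<exists>c. x i = Some (Inr c)}"
      have eq: "merge I (split I x) = x"
        unfolding I_def using xP by (rule merge_split)
      have I: "I \<subseteq> J" by (auto simp: I_def)
      have "split I x \<in> topspace (M I)"
        using continuous_map_image_subset_topspace[OF continuous_map_split[OF I]] xP by blast
      then have "split I x \<in> N I"
        using x xP eq unfolding N_def D_def by auto
      then have "merge I (split I x) \<in> merge I ` N I"
        by (rule imageI)
      then show "x \<in> (\<Union>I\<in>Pow J. merge I ` N I)"
        unfolding eq using I by blast
    qed
  qed
  moreover have "closedin P (\<Union>I\<in>Pow J. merge I ` N I)"
  proof (rule closedin_Union)
    show "finite ((\<lambda>I. merge I ` N I) ` Pow J)" using J by simp
  qed (use cpt compactin_imp_closedin[OF H] in blast)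
  ultimately have "closedin P (L \<inter> T)" by simp
  then show "closedin (subtopology P L) (L \<inter> T)"
    by (rule closedin_subset_topspace) blast
qed

section \<open>Closed sets of the wedge of smash products\<close>

lemma cartan_summand_eq: "cartan_summand J K B C E I = smash2 (Zhat I (full_subcomplex K I) C E) (W I)"
  unfolding cartan_summand_def Zhat_self[OF full_finite(2)] ..

lemma pts_Zhat_C: "I \<subseteq> J \<Longrightarrow> pts (Zhat I (full_subcomplex K I) C E) = ZC I"
  unfolding ZC_def by (rule pts_Zhat) (use E_subset in blast)

lemma pts_Zhat_U: "pts (decomposable_Zhat J K B C E) = ZU"
  unfolding decomposable_Zhat_def ZU_def using V_subset by (rule pts_Zhat)

lemma closedin_cartan_wedge:
  "closedin (spc (cartan_wedge J K B C E)) T \<longleftrightarrow>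
     T \<subseteq> pts (cartan_wedge J K B C E) \<and>
     (\<forall>I\<subseteq>J. closedin (kification (prod_topology (subtopology (spc (smash I C)) (ZC I)) (spc (W I))))
        {zw \<in> ZC I \<times> pts (W I). inc I zw \<in> T})"
proof -
  let ?A = "(\<lambda>I. (I, None)) ` Pow J"
  let ?X = "\<lambda>I. kification (prod_topology (subtopology (spc (smash I C)) (ZC I)) (spc (W I)))"
  have ptsum: "(\<lambda>I. (I, pt (cartan_summand J K B C E I))) ` Pow J = ?A"
    by (simp add: cartan_summand_eq)
  have summand: "closedin (spc (cartan_summand J K B C E I)) {y \<in> pts (cartan_summand J K B C E I). collapse_map ?A (I, y) \<in> T}
     \<longleftrightarrow> closedin (?X I) {zw \<in> ZC I \<times> pts (W I). inc I zw \<in> T}" if I: "I \<subseteq> J" for I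
  proof -
    have top: "topspace (?X I) = ZC I \<times> pts (W I)"
      using closedin_subset[OF closedin_ZC[OF I]] by (simp add: Int_absorb1)
    have "spc (Zhat I (full_subcomplex K I) C E) = subtopology (spc (smash I C)) (ZC I)"
      by (simp add: ZC_def Zhat_def subspace_pointed_def)
    then have sm: "cartan_summand J K B C E I = collapse (?X I) (axes (Zhat I (full_subcomplex K I) C E) (W I))"
      by (simp add: cartan_summand_eq smash2_def)
    show ?thesis
    proof -
      have "{zw \<in> topspace (?X I). collapse_map (axes (Zhat I (full_subcomplex K I) C E) (W I)) zw \<in>
             {y \<in> pts (cartan_summand J K B C E I). collapse_map ?A (I, y) \<in> T}} =
           {zw \<in> ZC I \<times> pts (W I). inc I zw \<in> T}"
        unfolding sm inc_def top[symmetric] using collapse_map_in_pts[of _ "?X I"] by blast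
      then show ?thesis
        unfolding sm closedin_collapse by auto
    qed
  qed
  have top: "topspace (sum_topology (\<lambda>I. spc (cartan_summand J K B C E I)) (Pow J)) =
      Sigma (Pow J) (\<lambda>I. pts (cartan_summand J K B C E I))"
    by (simp add: o_def)
  show ?thesis
    unfolding cartan_wedge_def wedge_def ptsum closedin_collapse closedin_sum_topology top
    using summand by (auto simp: o_def)
qed

text \<open>The product of the two quotient maps onto the factors of the \<open>I\<close>-th summand is a quotient map after
  kification. One factor is treated at a time, the other one being Hausdorff. The saturation
  hypothesis holds for every preimage under \<open>inc I\<close>; it controls the fibres over base points that
  are not hit, which occur when a factor has no index at all.\<close>
lemma closedin_kification_summand:
  assumes I: "I \<subseteq> J" and T: "T \<subseteq> ZC I \<times> pts (W I)"
    and sat: "\<And>z w z' w'. \<lbrakk>(z, w) \<in> T; z = None \<or> w = None; (z', w') \<in> ZC I \<times> pts (W I); z' = None \<or> w' = None\<rbrakk> \<Longrightarrow> (z', w') \<in> T"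
  shows "closedin (kification (prod_topology (subtopology (spc (smash I C)) (ZC I)) (spc (W I)))) T \<longleftrightarrow>
     closedin (kification (M I)) {p \<in> topspace (M I). (qC I (fst p), qB I (snd p)) \<in> T}"
    (is "?L \<longleftrightarrow> ?R")
proof -
  let ?Y = "spc (smash I C)" and ?Z = "spc (W I)"
  have SY: "ZC I \<subseteq> topspace ?Y" using closedin_subset[OF closedin_ZC[OF I]] .
  have "closedin (prod_topology ?Y ?Z) (ZC I \<times> topspace ?Z)"
    using closedin_ZC[OF I] by (simp add: closedin_prod_Times_iff)
  then have L: "?L \<longleftrightarrow> closedin (kification (prod_topology ?Y ?Z)) T"
    using T unfolding prod_topology_subtopology by (rule closedin_kification_subtopology)
  have fin: "finite I" "finite (J - I)" using J I finite_subset by auto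
  have HW: "Hausdorff_space ?Z"
    using fin B by (intro Hausdorff_space_smash) auto
  have HC: "Hausdorff_space (kification (PC I))"
    using C I by (intro Hausdorff_space_kification) (auto simp: Hausdorff_space_product_topology)
  have contC: "continuous_map (kification (PC I)) ?Y (qC I)" and contB: "continuous_map (kification (PB I)) ?Z (qB I)"
    unfolding smash_def by (rule continuous_map_collapse_map)+
  have finalC: "closedin ?Y D" if "D \<subseteq> topspace ?Y" "closedin (kification (PC I)) {x \<in> topspace (kification (PC I)). qC I x \<in> D}" for D
    using that unfolding smash_def closedin_collapse by blast
  have finalB: "closedin ?Z D" if "D \<subseteq> topspace ?Z" "closedin (kification (PB I)) {x \<in> topspace (kification (PB I)). qB I x \<in> D}" for D
    using that unfolding smash_def closedin_collapse by blast
  have missC: "z = None" if "z \<in> topspace ?Y" "z \<notin> qC I ` topspace (kification (PC I))" for z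
    using that unfolding smash_def pts_collapse by (auto simp: collapse_map_def image_iff)
  have missB: "z = None" if "z \<in> topspace ?Z" "z \<notin> qB I ` topspace (kification (PB I))" for z
    using that unfolding smash_def pts_collapse by (auto simp: collapse_map_def image_iff)
  have none: "(None, None) \<in> ZC I \<times> pts (W I)"
    using None_in_ZC[OF I] by (simp add: pts_smash)
  have satz: "(z, w) \<in> T \<longleftrightarrow> z \<in> ZC I \<and> w \<in> pts (W I) \<and> (None, None) \<in> T" if "z = None \<or> w = None" for z w
    using sat[of z w None None] sat[of None None z w] T none that by blast
  have sliceC: "(qC I c, None) \<in> T \<longleftrightarrow> qC I c \<in> ZC I \<and> (None, None) \<in> T" for c
    using satz[of "qC I c" None] none by blast
  have sliceB: "w \<in> pts (W I) \<Longrightarrow> (None, w) \<in> T \<longleftrightarrow> (None, None) \<in> T" for w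
    using satz[of None w] none by blast
  have qCin: "qC I c \<in> topspace ?Y" if "c \<in> topspace (PC I)" for c
    using continuous_map_image_subset_topspace[OF contC] that by (simp only: topspace_kification) blast
  have qBin: "qB I c \<in> topspace ?Z" if "c \<in> topspace (PB I)" for c
    using continuous_map_image_subset_topspace[OF contB] that by (simp only: topspace_kification) blast
  show ?thesis
  proof
    assume ?L
    then have T': "closedin (kification (prod_topology ?Y ?Z)) T" using L by simp
    have "continuous_map (kification (M I)) (prod_topology ?Y ?Z) (\<lambda>p. ((qC I \<circ> fst) p, (qB I \<circ> snd) p))"
      by (intro continuous_map_pairedI continuous_map_compose[OF _ contC] continuous_map_compose[OF _ contB]
          continuous_map_kification continuous_map_fst continuous_map_snd)
    then have "continuous_map (kification (M I)) (kification (prod_topology ?Y ?Z)) (\<lambda>p. (qC I (fst p), qB I (snd p)))"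
      by (simp add: continuous_map_into_kification)
    from closedin_continuous_map_preimage[OF this T'] show ?R by simp
  next
    assume R: ?R
    let ?kC = "kification (PC I)" and ?kB = "kification (PB I)"
    have "continuous_map (prod_topology ?kC ?kB) (M I) (\<lambda>p. ((id \<circ> fst) p, (id \<circ> snd) p))"
      by (intro continuous_map_pairedI continuous_map_compose[OF continuous_map_fst]
          continuous_map_compose[OF continuous_map_snd] continuous_map_from_kification continuous_map_id)
    then have "continuous_map (prod_topology ?kC ?kB) (M I) (\<lambda>p. (fst p, snd p))"
      by (simp only: id_comp)
    then have "continuous_map (kification (prod_topology ?kC ?kB)) (kification (M I)) (\<lambda>p. (fst p, snd p))"
      by (rule continuous_map_kification)
    \<comment> \<open>from here on the factor indexed by \<open>J - I\<close> is collapsed first, then the one indexed by \<open>I\<close>\<close>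
    from closedin_continuous_map_preimage[OF this R]
    have 1: "closedin (kification (prod_topology ?kC ?kB))
        {p \<in> topspace (PC I) \<times> topspace (PB I). (qC I (fst p), qB I (snd p)) \<in> T}"
      by (rule back_subst[of "closedin _"]) auto
    have 2: "closedin (kification (prod_topology ?kC ?Z)) {p \<in> topspace (PC I) \<times> topspace ?Z. (qC I (fst p), snd p) \<in> T}"
    proof (rule closedin_kification_prod_final_right[where X = ?kB and f = "qB I"])
      have "{p \<in> topspace ?kC \<times> topspace ?kB. (fst p, qB I (snd p)) \<in> {p \<in> topspace (PC I) \<times> topspace ?Z. (qC I (fst p), snd p) \<in> T}}
         = {p \<in> topspace (PC I) \<times> topspace (PB I). (qC I (fst p), qB I (snd p)) \<in> T}"
        using qBin by auto
      then show "closedin (kification (prod_topology ?kC ?kB))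
         {p \<in> topspace ?kC \<times> topspace ?kB. (fst p, qB I (snd p)) \<in> {p \<in> topspace (PC I) \<times> topspace ?Z. (qC I (fst p), snd p) \<in> T}}"
        using 1 by simp
      show "topspace ?Z \<subseteq> insert None (qB I ` topspace ?kB)"
        using missB by blast
      show "{p \<in> topspace (PC I) \<times> topspace ?Z. (qC I (fst p), snd p) \<in> T} \<subseteq> topspace ?kC \<times> topspace ?Z"
        by auto
      have "closedin ?kC {c \<in> topspace ?kC. qC I c \<in> ZC I}"
        using contC closedin_ZC[OF I] by (rule closedin_continuous_map_preimage)
      moreover have "{c \<in> topspace ?kC. (c, None) \<in> {p \<in> topspace (PC I) \<times> topspace ?Z. (qC I (fst p), snd p) \<in> T}} =
          (if (None, None) \<in> T then {c \<in> topspace ?kC. qC I c \<in> ZC I} else {})"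
        using none sliceC by auto
      ultimately show "closedin ?kC {c \<in> topspace ?kC. (c, None) \<in> {p \<in> topspace (PC I) \<times> topspace ?Z. (qC I (fst p), snd p) \<in> T}}"
        by (cases "(None, None) \<in> T") (simp_all only: if_True if_False closedin_empty simp_thms)
    qed (use contB finalB HC in auto)
    have "closedin (kification (prod_topology ?Y ?Z)) T"
    proof (rule closedin_kification_prod_final_left[where X = ?kC and f = "qC I"])
      show "closedin (kification (prod_topology ?kC ?Z)) {p \<in> topspace ?kC \<times> topspace ?Z. (qC I (fst p), snd p) \<in> T}"
        using 2 by simp
      show "T \<subseteq> topspace ?Y \<times> topspace ?Z" using T SY by blast
      show "topspace ?Y \<subseteq> insert None (qC I ` topspace ?kC)"
        using missC by blast
      have "{w \<in> topspace ?Z. (None, w) \<in> T} = (if (None, None) \<in> T then topspace ?Z else {})"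
        using sliceB by (cases "(None, None) \<in> T") (simp_all only: if_True if_False, blast+)
      then show "closedin ?Z {w \<in> topspace ?Z. (None, w) \<in> T}"
        by simp
    qed (use contC finalC HW in auto)
    then show ?L using L by simp
  qed
qed

section \<open>The bijection\<close>

text \<open>The tuple \<open>merge I p\<close> when no coordinate of \<open>p\<close> is a base point.\<close>
definition glue :: "'i set \<Rightarrow> ('i \<Rightarrow> 'c) \<times> ('i \<Rightarrow> 'b) \<Rightarrow> 'i \<Rightarrow> ('b + 'c) option" where
  "glue I p = (\<lambda>i\<in>J. Some (if i \<in> I then Inr (fst p i) else Inl (snd p i)))"

lemma merge_in_P: "p \<in> topspace (M I) \<Longrightarrow> merge I p \<in> topspace P"
  using continuous_map_image_subset_topspace[OF continuous_map_merge] by blast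

lemma merge_eq_None_iff:
  "i \<in> J \<Longrightarrow> merge I p i = None \<longleftrightarrow> (if i \<in> I then fst p i = pt (C i) else snd p i = pt (B i))"
  by (simp add: merge_def collapse_map_def)

lemma merge_in_fat_wedge_iff:
  assumes I: "I \<subseteq> J" and p: "p \<in> topspace (M I)"
  shows "merge I p \<in> fat_wedge J U \<longleftrightarrow> fst p \<in> fat_wedge I C \<or> snd p \<in> fat_wedge (J - I) B"
proof -
  have "fst p \<in> fat_wedge I C \<longleftrightarrow> (\<exists>i\<in>I. fst p i = pt (C i))"
    "snd p \<in> fat_wedge (J - I) B \<longleftrightarrow> (\<exists>i\<in>J - I. snd p i = pt (B i))"
    using p by (auto simp: fat_wedge_def)
  moreover have "merge I p \<in> fat_wedge J U \<longleftrightarrow> (\<exists>i\<in>J. merge I p i = None)"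
    using merge_in_P[OF p] by (simp add: fat_wedge_def)
  moreover have "(\<exists>i\<in>J. merge I p i = None) \<longleftrightarrow>
      (\<exists>i\<in>J. if i \<in> I then fst p i = pt (C i) else snd p i = pt (B i))"
    using merge_eq_None_iff by blast
  moreover have "\<dots> \<longleftrightarrow> (\<exists>i\<in>I. fst p i = pt (C i)) \<or> (\<exists>i\<in>J - I. snd p i = pt (B i))"
    using I by auto
  ultimately show ?thesis by blast
qed

lemma qU_merge_None:
  assumes I: "I \<subseteq> J" and p: "p \<in> topspace (M I)" and "qC I (fst p) = None \<or> qB I (snd p) = None"
  shows "qU (merge I p) = None"
  using assms(3) merge_in_fat_wedge_iff[OF I p] by (auto simp: collapse_map_def split: if_splits)

lemma qU_merge_Some:
  assumes I: "I \<subseteq> J" and p: "p \<in> topspace (M I)" and c: "qC I (fst p) \<noteq> None" and b: "qB I (snd p) \<noteq> None"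
  shows "qU (merge I p) = Some (glue I p)"
proof -
  have n: "fst p \<notin> fat_wedge I C" "snd p \<notin> fat_wedge (J - I) B"
    using c b by (auto simp: collapse_map_def)
  then have nm: "merge I p \<notin> fat_wedge J U"
    using merge_in_fat_wedge_iff[OF I p] by blast
  have "merge I p = glue I p"
  proof
    fix i show "merge I p i = glue I p i"
    proof (cases "i \<in> J")
      case True
      then have "merge I p i \<noteq> None"
        using nm merge_in_P[OF p] by (auto simp: fat_wedge_def)
      then show ?thesis using True by (auto simp: merge_def glue_def collapse_map_def split: if_splits)
    qed (simp add: merge_def glue_def)
  qed
  then show ?thesis using nm by (simp add: collapse_map_def)
qed

lemma inc_None:
  assumes "I \<subseteq> J" "z \<in> ZC I" "w \<in> pts (W I)" "z = None \<or> w = None"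
  shows "inc I (z, w) = None"
  using assms by (auto simp: inc_def axes_def collapse_map_def pts_Zhat_C)

lemma inc_Some: "inc I (Some c, Some b) = Some (I, Some (Some c, Some b))"
  by (auto simp: inc_def axes_def collapse_map_def)

lemma qC_in_ZC_iff:
  assumes "I \<subseteq> J" "c \<in> topspace (PC I)"
  shows "qC I c \<in> ZC I \<longleftrightarrow> c \<in> fat_wedge I C \<or> (\<exists>\<sigma>\<in>full_subcomplex K I. \<forall>i\<in>I - \<sigma>. c i \<in> E i)"
  unfolding ZC_def by (rule collapse_fat_wedge_in_Zhat_iff) (use assms full_finite E_subset in \<open>blast+\<close>)

lemma qU_in_ZU_iff:
  assumes "x \<in> topspace P"
  shows "qU x \<in> ZU \<longleftrightarrow> x \<in> fat_wedge J U \<or> (\<exists>\<sigma>\<in>K. \<forall>i\<in>J - \<sigma>. x i \<in> V i)"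
  unfolding ZU_def by (rule collapse_fat_wedge_in_Zhat_iff) (use assms K_finite V_subset in \<open>blast+\<close>)

lemma qB_in_W: "b \<in> topspace (PB I) \<Longrightarrow> qB I b \<in> pts (W I)"
  unfolding smash_def by (rule collapse_map_in_pts) simp

text \<open>Since \<open>B i \<subseteq> V i\<close> and \<open>C i \<inter> V i = E i\<close>, the condition that a simplex of \<open>K\<close> contains the indices
  outside \<open>V\<close> concerns only indices in \<open>I\<close>. A simplex \<open>\<sigma>\<close> with this property may be replaced
  by \<open>\<sigma> \<inter> I\<close>, which is a simplex of the full subcomplex. The second disjunct is there because a
  base point in the \<open>B\<close>-part sends the whole tuple to the base point.\<close>
lemma merge_in_ZU_iff:
  assumes I: "I \<subseteq> J" and p: "p \<in> topspace (M I)"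
  shows "qU (merge I p) \<in> ZU \<longleftrightarrow> qC I (fst p) \<in> ZC I \<or> qB I (snd p) = None"
proof (cases "qB I (snd p) = None \<or> qC I (fst p) = None")
  case True
  have "qC I (fst p) = None \<Longrightarrow> qC I (fst p) \<in> ZC I"
    using None_in_ZC[OF I] by simp
  moreover have "qU (merge I p) = None"
    using True qU_merge_None[OF I p] by blast
  ultimately show ?thesis
    using True None_in_ZU by metis
next
  case False
  then have n: "fst p \<notin> fat_wedge I C" "merge I p \<notin> fat_wedge J U" and m: "merge I p = glue I p"
    using qU_merge_Some[OF I p] by (auto simp: collapse_map_def split: if_splits)
  have fp: "fst p \<in> topspace (PC I)" using p by auto
  have V: "merge I p i \<in> V i \<longleftrightarrow> (i \<in> I \<longrightarrow> fst p i \<in> E i)" if i: "i \<in> J" for i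
  proof -
    have "merge I p i \<in> pts (U i)" using merge_in_P[OF p] i by auto
    moreover have "pinchr (pt (C i)) (merge I p i) = (if i \<in> I then fst p i else pt (C i))"
      unfolding m using i by (simp add: glue_def pinchr_def)
    ultimately show ?thesis using V_iff[OF i] E[OF i] by simp
  qed
  have "(\<exists>\<sigma>\<in>K. \<forall>i\<in>J - \<sigma>. merge I p i \<in> V i) \<longleftrightarrow> (\<exists>\<sigma>\<in>full_subcomplex K I. \<forall>i\<in>I - \<sigma>. fst p i \<in> E i)"
  proof
    assume "\<exists>\<sigma>\<in>K. \<forall>i\<in>J - \<sigma>. merge I p i \<in> V i"
    then obtain \<sigma> where s: "\<sigma> \<in> K" "\<And>i. i \<in> J - \<sigma> \<Longrightarrow> merge I p i \<in> V i" by blast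
    have "\<sigma> \<inter> I \<in> full_subcomplex K I"
      using K s(1) by (auto simp: simplicial_complex_on_def full_subcomplex_def)
    moreover have "\<forall>i\<in>I - \<sigma> \<inter> I. fst p i \<in> E i"
      using s(2) V I by blast
    ultimately show "\<exists>\<sigma>\<in>full_subcomplex K I. \<forall>i\<in>I - \<sigma>. fst p i \<in> E i" by blast
  next
    assume "\<exists>\<sigma>\<in>full_subcomplex K I. \<forall>i\<in>I - \<sigma>. fst p i \<in> E i"
    then show "\<exists>\<sigma>\<in>K. \<forall>i\<in>J - \<sigma>. merge I p i \<in> V i"
      using V by (auto simp: full_subcomplex_def)
  qed
  then show ?thesis
    using qU_in_ZU_iff[OF merge_in_P[OF p]] qC_in_ZC_iff[OF I fp] n False by blast
qed

text \<open>On each piece \<open>cartan_map\<close> and its inverse intertwine the two quotient maps starting at \<open>M I\<close>. Both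
  the bijectivity and the continuity statements reduce to these two equations.\<close>
lemma cartan_map_merge:
  assumes I: "I \<subseteq> J" and p: "p \<in> topspace (M I)" and c: "qC I (fst p) \<in> ZC I"
  shows "cartan_map J (qU (merge I p)) = inc I (qC I (fst p), qB I (snd p))"
    and "cartan_inverse J (inc I (qC I (fst p), qB I (snd p))) = qU (merge I p)"
proof -
  have "cartan_map J (qU (merge I p)) = inc I (qC I (fst p), qB I (snd p)) \<and>
      cartan_inverse J (inc I (qC I (fst p), qB I (snd p))) = qU (merge I p)"
  proof (cases "qC I (fst p) = None \<or> qB I (snd p) = None")
    case True
    have "snd p \<in> topspace (PB I)" using p by auto
    then have "inc I (qC I (fst p), qB I (snd p)) = None"
      using inc_None[OF I c qB_in_W True] by blast
    then show ?thesis
      using qU_merge_None[OF I p True] by (simp add: cartan_map_def cartan_inverse_def)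
  next
    case False
    then have q: "qC I (fst p) = Some (fst p)" "qB I (snd p) = Some (snd p)"
      by (auto simp: collapse_map_def)
    have "fst p \<in> extensional I" "snd p \<in> extensional (J - I)"
      using p by (auto simp: PiE_iff)
    moreover have "{i \<in> J. \<exists>c. glue I p i = Some (Inr c)} = I"
      using I by (auto simp: glue_def)
    moreover have "(\<lambda>i\<in>I. projr (the (glue I p i))) = (\<lambda>i\<in>I. fst p i)"
        "(\<lambda>j\<in>J - I. projl (the (glue I p j))) = (\<lambda>j\<in>J - I. snd p j)"
      using I by (auto simp: glue_def fun_eq_iff)
    ultimately have "cartan_map J (Some (glue I p)) = Some (I, Some (Some (fst p), Some (snd p)))"
      by (simp only: cartan_map_def option.case Let_def extensional_restrict)
    moreover have "cartan_inverse J (Some (I, Some (Some (fst p), Some (snd p)))) = Some (glue I p)"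
      by (simp add: cartan_inverse_def glue_def)
    ultimately show ?thesis
      using qU_merge_Some[OF I p] False by (simp add: q inc_Some)
  qed
  then show "cartan_map J (qU (merge I p)) = inc I (qC I (fst p), qB I (snd p))"
    and "cartan_inverse J (inc I (qC I (fst p), qB I (snd p))) = qU (merge I p)" by auto
qed

lemma ZU_cases:
  assumes z: "z \<in> ZU"
  obtains (base) "z = None"
  | (merge) I p where "I \<subseteq> J" "p \<in> topspace (M I)" "qC I (fst p) \<in> ZC I" "z = qU (merge I p)"
proof (cases z)
  case (Some x)
  have "x \<in> (\<Pi>\<^sub>E i\<in>J. pts (U i) - {pt (U i)})"
    using z closedin_subset[OF closedin_ZU] by (auto simp: Some pts_smash)
  then have xP: "x \<in> topspace P" and nf: "x \<notin> fat_wedge J U"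
    by (auto simp: fat_wedge_def PiE_iff)
  define I where "I = {i \<in> J. \<exists>c. x i = Some (Inr c)}"
  have eq: "merge I (split I x) = x"
    unfolding I_def using xP by (rule merge_split)
  have I: "I \<subseteq> J" by (auto simp: I_def)
  have p: "split I x \<in> topspace (M I)"
    using continuous_map_image_subset_topspace[OF continuous_map_split[OF I]] xP by blast
  have q: "qU (merge I (split I x)) = z"
    using nf by (simp add: eq Some collapse_map_def)
  then have "qB I (snd (split I x)) \<noteq> None"
    using qU_merge_None[OF I p] Some by auto
  then have "qC I (fst (split I x)) \<in> ZC I"
    using merge_in_ZU_iff[OF I p] z q by metis
  then show ?thesis
    using merge[OF I p] q by simp
qed (use base in simp)

lemma pts_summand: "I \<subseteq> J \<Longrightarrow> pts (cartan_summand J K B C E I) =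
   insert None (Some ` (ZC I \<times> pts (W I) - axes (Zhat I (full_subcomplex K I) C E) (W I)))"
  unfolding cartan_summand_eq smash2_def pts_collapse
  by (simp only: topspace_kification topspace_prod_topology pts_Zhat_C)

lemma pts_cartan_wedge: "pts (cartan_wedge J K B C E) =
   insert None (Some ` (Sigma (Pow J) (\<lambda>I. pts (cartan_summand J K B C E I)) - (\<lambda>I. (I, None)) ` Pow J))"
proof -
  have "(\<lambda>I. (I, pt (cartan_summand J K B C E I))) ` Pow J = (\<lambda>I. (I, None)) ` Pow J"
    by (simp add: cartan_summand_eq)
  then show ?thesis
    unfolding cartan_wedge_def wedge_def pts_collapse by (simp add: o_def)
qed

lemma inc_in_pts:
  assumes I: "I \<subseteq> J" and z: "z \<in> ZC I" and w: "w \<in> pts (W I)"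
  shows "inc I (z, w) \<in> pts (cartan_wedge J K B C E)"
proof (cases "z = None \<or> w = None")
  case True
  then show ?thesis using inc_None[OF I z w] by (simp add: pts_cartan_wedge)
next
  case False
  then obtain c b where cb: "z = Some c" "w = Some b" by auto
  have "(z, w) \<in> ZC I \<times> pts (W I) - axes (Zhat I (full_subcomplex K I) C E) (W I)"
    using z w by (simp add: cb axes_def)
  then show ?thesis
    using I by (auto simp: cb inc_Some pts_cartan_wedge pts_summand)
qed

lemma wedge_cases:
  assumes w: "w \<in> pts (cartan_wedge J K B C E)"
  obtains (base) "w = None"
  | (inc) I p where "I \<subseteq> J" "p \<in> topspace (M I)" "qC I (fst p) \<in> ZC I" "w = inc I (qC I (fst p), qB I (snd p))"
proof (cases w)
  case (Some v)
  obtain I y where v: "v = (I, y)" by (cases v)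
  have "(I, y) \<in> Sigma (Pow J) (\<lambda>I. pts (cartan_summand J K B C E I)) - (\<lambda>I. (I, None)) ` Pow J"
    using w unfolding pts_cartan_wedge Some v
    by (simp only: insert_iff option.distinct inj_image_mem_iff[OF inj_Some] simp_thms)
  then have I: "I \<subseteq> J" and y: "y \<in> pts (cartan_summand J K B C E I)"
    and image: "(I, y) \<notin> (\<lambda>I. (I, None)) ` Pow J"
    by (simp_all only: Diff_iff mem_Sigma_iff Pow_iff simp_thms)
  have "y = None \<Longrightarrow> (I, y) \<in> (\<lambda>I. (I, None)) ` Pow J"
    using I by (intro image_eqI[where x = I]) (simp_all only: Pow_iff)
  then have ny: "y \<noteq> None" using image by metis
  obtain z u where yz: "y = Some (z, u)" using ny by (cases y) auto
  have zu: "z \<in> ZC I" "u \<in> pts (W I)" "(z, u) \<notin> axes (Zhat I (full_subcomplex K I) C E) (W I)"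
    using y by (auto simp: yz pts_summand[OF I])
  then have "z \<noteq> None" "u \<noteq> None"
    using pts_Zhat_C[OF I] by (auto simp: axes_def)
  then obtain c b where cb: "z = Some c" "u = Some b" by auto
  have c: "c \<in> (\<Pi>\<^sub>E i\<in>I. pts (C i) - {pt (C i)})"
    using zu(1) closedin_subset[OF closedin_ZC[OF I]] by (auto simp: cb pts_smash)
  have b: "b \<in> (\<Pi>\<^sub>E i\<in>J - I. pts (B i) - {pt (B i)})"
    using zu(2) by (auto simp: cb pts_smash)
  have p: "(c, b) \<in> topspace (M I)"
    using c b by (auto simp: PiE_iff)
  have "c \<notin> fat_wedge I C" "b \<notin> fat_wedge (J - I) B"
    using c b by (auto simp: fat_wedge_def PiE_iff)
  then have q: "qC I c = Some c" "qB I b = Some b"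
    by (simp_all add: collapse_map_def)
  have "w = inc I (Some c, Some b)"
    by (simp add: Some v yz cb inc_Some)
  then show ?thesis
    using inc[OF I p] zu(1) by (simp add: q cb)
qed (use base in simp)

lemma cartan_inverse_cartan_map:
  assumes "z \<in> ZU"
  shows "cartan_map J z \<in> pts (cartan_wedge J K B C E)" "cartan_inverse J (cartan_map J z) = z"
proof -
  have "cartan_map J z \<in> pts (cartan_wedge J K B C E) \<and> cartan_inverse J (cartan_map J z) = z"
    using assms
  proof (cases rule: ZU_cases)
    case base
    then show ?thesis by (simp add: cartan_map_def cartan_inverse_def pts_cartan_wedge)
  next
    case (merge I p)
    have "snd p \<in> topspace (PB I)" using merge(2) by auto
    then show ?thesis
      using cartan_map_merge[OF merge(1-3)] inc_in_pts[OF merge(1,3) qB_in_W]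
      unfolding merge(4) by metis
  qed
  then show "cartan_map J z \<in> pts (cartan_wedge J K B C E)" "cartan_inverse J (cartan_map J z) = z" by auto
qed

lemma cartan_map_cartan_inverse:
  assumes "w \<in> pts (cartan_wedge J K B C E)"
  shows "cartan_inverse J w \<in> ZU" "cartan_map J (cartan_inverse J w) = w"
proof -
  have "cartan_inverse J w \<in> ZU \<and> cartan_map J (cartan_inverse J w) = w"
    using assms
  proof (cases rule: wedge_cases)
    case base
    then show ?thesis using None_in_ZU by (simp add: cartan_map_def cartan_inverse_def)
  next
    case (inc I p)
    then show ?thesis
      using cartan_map_merge[OF inc(1-3)] merge_in_ZU_iff[OF inc(1,2)] by metis
  qed
  then show "cartan_inverse J w \<in> ZU" "cartan_map J (cartan_inverse J w) = w" by auto
qed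

section \<open>Continuity in both directions\<close>

lemma spc_Zhat_U: "spc (decomposable_Zhat J K B C E) = subtopology (spc (smash J U)) ZU"
  by (simp add: ZU_def decomposable_Zhat_def Zhat_def subspace_pointed_def)

lemma inc_saturated:
  assumes I: "I \<subseteq> J" and "(z, w) \<in> {zw \<in> ZC I \<times> pts (W I). inc I zw \<in> T}" "z = None \<or> w = None"
    and "(z', w') \<in> ZC I \<times> pts (W I)" "z' = None \<or> w' = None"
  shows "(z', w') \<in> {zw \<in> ZC I \<times> pts (W I). inc I zw \<in> T}"
  using assms inc_None[OF I, of z w] inc_None[OF I, of z' w'] by auto

lemma closedin_fst_ZC:
  assumes I: "I \<subseteq> J"
  shows "closedin (kification (M I)) {p \<in> topspace (M I). qC I (fst p) \<in> ZC I}"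
proof -
  have "continuous_map (kification (M I)) (spc (smash I C)) (qC I \<circ> fst)"
    unfolding smash_def
    by (intro continuous_map_compose[OF _ continuous_map_collapse_map] continuous_map_kification continuous_map_fst)
  from closedin_continuous_map_preimage[OF this closedin_ZC[OF I]] show ?thesis
    by (simp only: o_apply topspace_kification)
qed

lemma closedin_snd_None:
  "closedin (kification (M I)) {p \<in> topspace (M I). qB I (snd p) = None}"
proof -
  have "closedin (PB I) (fat_wedge (J - I) B)"
    using J B by (intro closedin_fat_wedge) auto
  then have "closedin (M I) {p \<in> topspace (M I). snd p \<in> fat_wedge (J - I) B}"
    by (rule closedin_continuous_map_preimage[OF continuous_map_snd])
  moreover have "qB I b = None \<longleftrightarrow> b \<in> fat_wedge (J - I) B" for b
    by (simp add: collapse_map_def)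
  ultimately show ?thesis
    by (simp only: closedin_kification_finer)
qed

text \<open>The preimage of a closed set is tested on every piece. There it consists of the closed preimage in
  the \<open>I\<close>-th summand and, if the base point belongs to the closed set, also of the tuples with a
  base point in the \<open>B\<close>-part, for which the \<open>C\<close>-part is arbitrary.\<close>
lemma continuous_map_cartan_map:
  "continuous_map (spc (decomposable_Zhat J K B C E)) (spc (cartan_wedge J K B C E)) (cartan_map J)"
  unfolding continuous_map_closedin pts_Zhat_U
proof (intro conjI allI impI)
  show "cartan_map J \<in> ZU \<rightarrow> pts (cartan_wedge J K B C E)"
    using cartan_inverse_cartan_map(1) by blast
  fix T assume T: "closedin (spc (cartan_wedge J K B C E)) T"
  let ?T = "{z \<in> ZU. cartan_map J z \<in> T}"
  have "closedin (spc (smash J U)) ?T"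
    unfolding smash_def closedin_collapse
  proof
    show "?T \<subseteq> pts (collapse (kification P) (fat_wedge J U))"
      using closedin_subset[OF closedin_ZU] by (auto simp: smash_def)
    have "closedin (kification P) {x \<in> topspace P. qU x \<in> ?T}"
    proof (rule closedin_kification_cover)
      fix I assume I: "I \<subseteq> J"
      let ?TI = "{zw \<in> ZC I \<times> pts (W I). inc I zw \<in> T}"
      have "closedin (kification (prod_topology (subtopology (spc (smash I C)) (ZC I)) (spc (W I)))) ?TI"
        using T I unfolding closedin_cartan_wedge by blast
      then have 1: "closedin (kification (M I)) {p \<in> topspace (M I). (qC I (fst p), qB I (snd p)) \<in> ?TI}"
        by (subst (asm) closedin_kification_summand[OF I]) (use inc_saturated[OF I] in blast)+
      have "{p \<in> topspace (M I). merge I p \<in> {x \<in> topspace P. qU x \<in> ?T}} =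
        {p \<in> topspace (M I). (qC I (fst p), qB I (snd p)) \<in> ?TI} \<union>
        (if None \<in> T then {p \<in> topspace (M I). qB I (snd p) = None} else {})" (is "?L = ?R")
      proof (rule set_eqI)
        fix p
        show "p \<in> ?L \<longleftrightarrow> p \<in> ?R"
        proof (cases "p \<in> topspace (M I)")
          case True
          then have b: "qB I (snd p) \<in> pts (W I)" by (intro qB_in_W) auto
          have L: "p \<in> ?L \<longleftrightarrow> (qC I (fst p) \<in> ZC I \<or> qB I (snd p) = None) \<and> cartan_map J (qU (merge I p)) \<in> T"
            unfolding mem_Collect_eq merge_in_ZU_iff[OF I True] using True merge_in_P[OF True] by (simp only: simp_thms)
          have R: "p \<in> ?R \<longleftrightarrow> (qC I (fst p) \<in> ZC I \<and> inc I (qC I (fst p), qB I (snd p)) \<in> T) \<or> (None \<in> T \<and> qB I (snd p) = None)"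
            using True b by (cases "None \<in> T")
              (simp_all only: if_True if_False Un_iff mem_Collect_eq mem_Times_iff fst_conv snd_conv empty_iff simp_thms)
          have n: "qB I (snd p) = None \<Longrightarrow> cartan_map J (qU (merge I p)) = None"
            using qU_merge_None[OF I True] by (simp add: cartan_map_def)
          show ?thesis
            unfolding L R using cartan_map_merge(1)[OF I True] n by metis
        qed auto
      qed
      moreover have "closedin (kification (M I)) ?R"
        using 1 closedin_snd_None by (intro closedin_Un) (auto simp only: closedin_empty split: if_split)
      ultimately show "closedin (kification (M I)) ?L" by (simp only:)
    qed blast
    then show "closedin (kification P) {x \<in> topspace (kification P). qU x \<in> ?T}"
      by (simp only: topspace_kification)
  qed
  then show "closedin (spc (decomposable_Zhat J K B C E)) ?T"
    unfolding spc_Zhat_U by (rule closedin_subset_topspace) blast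
qed

text \<open>Closed sets of the \<open>I\<close>-th summand are tested on a closed subset of the kification of \<open>M I\<close>, where
  the map becomes \<open>merge I\<close> followed by the projection to the smash product.\<close>
lemma continuous_map_cartan_inverse:
  "continuous_map (spc (cartan_wedge J K B C E)) (spc (decomposable_Zhat J K B C E)) (cartan_inverse J)"
  unfolding continuous_map_closedin pts_Zhat_U
proof (intro conjI allI impI)
  show "cartan_inverse J \<in> pts (cartan_wedge J K B C E) \<rightarrow> ZU"
    using cartan_map_cartan_inverse(1) by blast
  fix T assume "closedin (spc (decomposable_Zhat J K B C E)) T"
  then have "closedin (spc (smash J U)) T"
    unfolding spc_Zhat_U using closedin_ZU closedin_trans_full by blast
  then have T: "closedin (kification P) {x \<in> topspace (kification P). qU x \<in> T}"
    unfolding smash_def closedin_collapse by blast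
  let ?T = "{w \<in> pts (cartan_wedge J K B C E). cartan_inverse J w \<in> T}"
  show "closedin (spc (cartan_wedge J K B C E)) ?T"
    unfolding closedin_cartan_wedge
  proof (intro conjI allI impI)
    fix I assume I: "I \<subseteq> J"
    let ?TI = "{zw \<in> ZC I \<times> pts (W I). inc I zw \<in> ?T}"
    have "closedin (kification (M I)) {p \<in> topspace (kification (M I)). merge I p \<in> {x \<in> topspace (kification P). qU x \<in> T}}"
      by (rule closedin_continuous_map_preimage[OF continuous_map_kification[OF continuous_map_merge] T])
    from closedin_Int[OF closedin_fst_ZC[OF I] this]
    have "closedin (kification (M I)) {p \<in> topspace (M I). (qC I (fst p), qB I (snd p)) \<in> ?TI}"
    proof (rule back_subst[of "closedin _"], intro set_eqI)
      fix p
      show "p \<in> {p \<in> topspace (M I). qC I (fst p) \<in> ZC I} \<inter>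
             {p \<in> topspace (kification (M I)). merge I p \<in> {x \<in> topspace (kification P). qU x \<in> T}} \<longleftrightarrow>
          p \<in> {p \<in> topspace (M I). (qC I (fst p), qB I (snd p)) \<in> ?TI}"
      proof (cases "p \<in> topspace (M I) \<and> qC I (fst p) \<in> ZC I")
        case True
        then have p: "p \<in> topspace (M I)" and c: "qC I (fst p) \<in> ZC I" by auto
        have b: "qB I (snd p) \<in> pts (W I)" using p by (intro qB_in_W) auto
        show ?thesis
          using p c b merge_in_P[OF p] inc_in_pts[OF I c b] cartan_map_merge(2)[OF I p c]
          unfolding topspace_kification by auto
      qed auto
    qed
    then show "closedin (kification (prod_topology (subtopology (spc (smash I C)) (ZC I)) (spc (W I)))) ?TI"
      by (subst closedin_kification_summand[OF I]) (use inc_saturated[OF I] in blast)+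
  qed blast
qed

lemma pt_cartan_wedge [simp]: "pt (cartan_wedge J K B C E) = None"
  by (simp add: cartan_wedge_def)

lemma pt_Zhat_U [simp]: "pt (decomposable_Zhat J K B C E) = None"
  by (simp add: decomposable_Zhat_def)

theorem pointed_homotopy_equivalence_cartan_map:
  "pointed_homotopy_equivalence (decomposable_Zhat J K B C E) (cartan_wedge J K B C E) (cartan_map J)"
proof -
  have None: "cartan_map J None = None" "cartan_inverse J None = None"
    by (simp_all add: cartan_map_def cartan_inverse_def)
  show ?thesis
    unfolding pointed_homotopy_equivalence_def pointed_map_def pt_cartan_wedge pt_Zhat_U
  proof (intro conjI exI[of _ "cartan_inverse J"])
    show "homotopic_with (\<lambda>h. h None = None) (spc (decomposable_Zhat J K B C E)) (spc (decomposable_Zhat J K B C E))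
        (cartan_inverse J \<circ> cartan_map J) id"
      by (rule homotopic_with_equal)
        (use continuous_map_compose[OF continuous_map_cartan_map continuous_map_cartan_inverse]
          cartan_inverse_cartan_map(2) in \<open>simp_all add: None pts_Zhat_U\<close>)
    show "homotopic_with (\<lambda>h. h None = None) (spc (cartan_wedge J K B C E)) (spc (cartan_wedge J K B C E))
        (cartan_map J \<circ> cartan_inverse J) id"
      by (rule homotopic_with_equal)
        (use continuous_map_compose[OF continuous_map_cartan_inverse continuous_map_cartan_map]
          cartan_map_cartan_inverse(2) in \<open>simp_all add: None\<close>)
  qed (simp_all add: None continuous_map_cartan_map continuous_map_cartan_inverse)
qed

end

section \<open>Naturality\<close>

text \<open>Complexes are Hausdorff and contain their base vertices, and subcomplexes are closed.\<close>
lemma decomposable_family_wedge_decomposable: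
  assumes "finite J" "simplicial_complex_on J K" "wedge_decomposable J B C E"
  shows "decomposable_family J K B C E"
proof
  have vertex: "Hausdorff_space (spc X) \<and> pt X \<in> pts X" if "cw_structure (spc X) \<C> d" "{pt X} \<in> \<C>" for X :: "'z pointed" and \<C> d
    using that by (auto simp: cw_structure_def)
  fix i assume i: "i \<in> J"
  have Bi: "pointed_CW_complex (B i)" and Ci: "pointed_CW_pair (C i) (E i)"
    using assms(3) i by (auto simp: wedge_decomposable_def)
  show "Hausdorff_space (spc (B i)) \<and> pt (B i) \<in> pts (B i)"
    using Bi vertex unfolding pointed_CW_complex_def by blast
  show "Hausdorff_space (spc (C i)) \<and> pt (C i) \<in> pts (C i)"
    using Ci vertex unfolding pointed_CW_pair_def by blast
  show "closedin (spc (C i)) (E i) \<and> pt (C i) \<in> E i"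
    using Ci closedin_cw_subcomplex unfolding pointed_CW_pair_def by blast
qed (use assms in auto)

text \<open>Maps of decomposable pairs act coordinatewise and preserve the summand in which a coordinate lies,
  so they commute with \<open>merge I\<close>; a coordinate that is sent to a base point turns both sides into
  the base point.\<close>
lemma cartan_map_natural:
  assumes F: "decomposable_family J K B C E" and F': "decomposable_family J K B' C' E'"
    and map: "decomposable_map J B C E B' C' E' \<beta> \<gamma>"
    and z: "z \<in> pts (decomposable_Zhat J K B C E)"
  shows "cartan_map J (decomposable_Zhat_map J B' C' \<beta> \<gamma> z) =
         cartan_wedge_map J K B' C' E' \<beta> \<gamma> (cartan_map J z)"
proof -
  interpret F: decomposable_family J K B C E by (fact F)
  interpret F': decomposable_family J K B' C' E' by (fact F')
  have "z \<in> F.ZU" using z F.pts_Zhat_U by simp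
  then show ?thesis
  proof (cases rule: F.ZU_cases)
    case base
    then show ?thesis
      by (simp add: decomposable_Zhat_map_def cartan_map_def cartan_wedge_map_def smash_map_def
          wedge_map_def collapse_fun_def)
  next
    case (merge I p)
    show ?thesis
    proof (cases "F.qC I (fst p) = None \<or> F.qB I (snd p) = None")
      case True
      then have "z = None" using F.qU_merge_None[OF merge(1,2)] merge(4) by simp
      then show ?thesis
        by (simp add: decomposable_Zhat_map_def cartan_map_def cartan_wedge_map_def smash_map_def
            wedge_map_def collapse_fun_def)
    next
      case False
      then have q: "F.qC I (fst p) = Some (fst p)" "F.qB I (snd p) = Some (snd p)" and nf: "fst p \<notin> fat_wedge I C"
        by (auto simp: collapse_map_def)
      have zg: "z = Some (F.glue I p)"
        using F.qU_merge_Some[OF merge(1,2)] False merge(4) by simp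
      have w: "cartan_map J z = Some (I, Some (Some (fst p), Some (snd p)))"
        using F.cartan_map_merge(1)[OF merge(1-3)] by (simp add: merge(4) q F.inc_Some)
      define p' where "p' = (\<lambda>i\<in>I. \<gamma> i (fst p i), \<lambda>j\<in>J - I. \<beta> j (snd p j))"
      have cont: "\<beta> i \<in> pts (B i) \<rightarrow> pts (B' i)" "\<gamma> i \<in> pts (C i) \<rightarrow> pts (C' i)" "\<gamma> i ` E i \<subseteq> E' i" if "i \<in> J" for i
        using map that by (auto simp: decomposable_map_def pointed_map_def continuous_map_def)
      have "fst p \<in> topspace (F.PC I)" and "snd p \<in> topspace (F.PB I)"
        using merge(2) by auto
      then have fp': "fst p' \<in> topspace (F'.PC I)" and "snd p' \<in> topspace (F'.PB I)"
        using cont merge(1) unfolding p'_def by (auto simp: PiE_iff Pi_iff)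
      then have p': "p' \<in> topspace (F'.M I)" by (simp add: mem_Times_iff)
      have "F.qC I (fst p) \<in> F.ZC I \<longleftrightarrow> (\<exists>\<sigma>\<in>full_subcomplex K I. \<forall>i\<in>I - \<sigma>. fst p i \<in> E i)"
        using F.qC_in_ZC_iff[OF merge(1) \<open>fst p \<in> topspace (F.PC I)\<close>] nf by blast
      then obtain \<sigma> where \<sigma>: "\<sigma> \<in> full_subcomplex K I" "\<And>i. i \<in> I - \<sigma> \<Longrightarrow> fst p i \<in> E i"
        using merge(3) by blast
      have "fst p' i \<in> E' i" if "i \<in> I - \<sigma>" for i
        using \<sigma>(2)[OF that] cont(3)[of i] that merge(1) by (auto simp: p'_def)
      then have c': "F'.qC I (fst p') \<in> F'.ZC I"
        using F'.qC_in_ZC_iff[OF merge(1) fp'] \<sigma>(1) by blast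
      have "(\<lambda>i\<in>J. wedge2_map (B' i) (C' i) (\<beta> i) (\<gamma> i) (F.glue I p i)) = F'.merge I p'"
        using merge(1) by (auto simp: fun_eq_iff F.glue_def F'.merge_def wedge2_map_def collapse_fun_def p'_def)
      then have "decomposable_Zhat_map J B' C' \<beta> \<gamma> z = F'.qU (F'.merge I p')"
        by (simp add: zg decomposable_Zhat_map_def smash_map_def collapse_fun_def)
      then have "cartan_map J (decomposable_Zhat_map J B' C' \<beta> \<gamma> z) = F'.inc I (F'.qC I (fst p'), F'.qB I (snd p'))"
        using F'.cartan_map_merge(1)[OF merge(1) p' c'] by simp
      also have "\<dots> = cartan_wedge_map J K B' C' E' \<beta> \<gamma> (cartan_map J z)"
      proof -
        have "Zhat (J - I) (full_subcomplex K (J - I)) B' (\<lambda>j. pts (B' j)) = smash (J - I) B'"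
          by (rule Zhat_self) (fact F'.full_finite)
        moreover have "(\<lambda>I. (I, pt (cartan_summand J K B' C' E' I))) ` Pow J = (\<lambda>I. (I, None)) ` Pow J"
          by (simp add: F'.cartan_summand_eq)
        ultimately show ?thesis
          by (simp add: w cartan_wedge_map_def wedge_map_def smash2_map_def smash_map_def collapse_fun_def
              F'.inc_def p'_def)
      qed
      finally show ?thesis .
    qed
  qed
qed

section \<open>The Cartan formula\<close>

theorem theorem2p2:
  fixes m :: nat and K :: "nat set set"
  assumes "simplicial_complex_on {1..m} K"
  shows
    "(\<exists>\<Phi> :: (nat \<Rightarrow> 'b pointed) \<Rightarrow> (nat \<Rightarrow> 'c pointed) \<Rightarrow> (nat \<Rightarrow> 'c set) \<Rightarrow>
         (nat \<Rightarrow> ('b + 'c) option) option \<Rightarrow>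
         (nat set \<times> ((nat \<Rightarrow> 'c) option \<times> (nat \<Rightarrow> 'b) option) option) option.
        (\<forall>B C E. wedge_decomposable {1..m} B C E \<longrightarrow>
           pointed_homotopy_equivalence
             (decomposable_Zhat {1..m} K B C E) (cartan_wedge {1..m} K B C E) (\<Phi> B C E)) \<and>
        (\<forall>B C E B' C' E' \<beta> \<gamma>.
           wedge_decomposable {1..m} B C E \<and> wedge_decomposable {1..m} B' C' E' \<and>
           decomposable_map {1..m} B C E B' C' E' \<beta> \<gamma> \<longrightarrow>
           (\<forall>x \<in> pts (decomposable_Zhat {1..m} K B C E).
              \<Phi> B' C' E' (decomposable_Zhat_map {1..m} B' C' \<beta> \<gamma> x) =
              cartan_wedge_map {1..m} K B' C' E' \<beta> \<gamma> (\<Phi> B C E x)))) \<and>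
     (\<forall>(B :: nat \<Rightarrow> 'b pointed) I.
        (\<forall>i\<in>{1..m}. pointed_CW_complex (B i)) \<and> I \<subseteq> {1..m} \<longrightarrow>
        Zhat ({1..m} - I) (full_subcomplex K ({1..m} - I)) B (\<lambda>j. pts (B j)) =
        smash ({1..m} - I) B)"
proof (intro conjI exI[of _ "\<lambda>B C E. cartan_map {1..m}"] allI impI ballI)
  fix B :: "nat \<Rightarrow> 'b pointed" and C :: "nat \<Rightarrow> 'c pointed" and E
  assume "wedge_decomposable {1..m} B C E"
  then show "pointed_homotopy_equivalence
      (decomposable_Zhat {1..m} K B C E) (cartan_wedge {1..m} K B C E) (cartan_map {1..m})"
    by (intro decomposable_family.pointed_homotopy_equivalence_cartan_map
        decomposable_family_wedge_decomposable assms) auto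
next
  fix B B' :: "nat \<Rightarrow> 'b pointed" and C C' :: "nat \<Rightarrow> 'c pointed" and E E' \<beta> \<gamma> x
  assume "wedge_decomposable {1..m} B C E \<and> wedge_decomposable {1..m} B' C' E' \<and>
      decomposable_map {1..m} B C E B' C' E' \<beta> \<gamma>"
    and "x \<in> pts (decomposable_Zhat {1..m} K B C E)"
  then show "cartan_map {1..m} (decomposable_Zhat_map {1..m} B' C' \<beta> \<gamma> x) =
      cartan_wedge_map {1..m} K B' C' E' \<beta> \<gamma> (cartan_map {1..m} x)"
    by (intro cartan_map_natural decomposable_family_wedge_decomposable assms) auto
next
  fix B :: "nat \<Rightarrow> 'b pointed" and I
  have "{} \<in> full_subcomplex K ({1..m} - I)"
    using assms by (simp add: simplicial_complex_on_def full_subcomplex_def)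
  then show "Zhat ({1..m} - I) (full_subcomplex K ({1..m} - I)) B (\<lambda>j. pts (B j)) = smash ({1..m} - I) B"
    by (intro Zhat_self) auto
qed

end
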